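(* Let $k\ge3$ be an integer. If $k\equiv0\pmod{4}$, then any strictly increasing infinite sequence of positive integers on which $r_{4,+}^{k}$ is bounded converges $2$-adically to $(k-4)^2/(4-2k)\in\mathbb{Z}_2$. If $k\not\equiv0\pmod{4}$, then there is no strictly increasing infinite sequence of positive integers on which $r_{4,+}^{k}$ is bounded.
   Context: Let $p_k(x)=\frac{(k-2)x^2-(k-4)x}{2}$; $r_{4,+}^{k}(N)=\#\{\mathbf{x}\in\mathbb{Z}_{\ge0}^4:\sum_{i=1}^4 p_k(x_i)=N\}$ is the number of representations of $N$ as a sum of four ordinary $k$-gonal numbers. $\mathbb{Z}_2$ denotes the $2$-adic integers. "$r_{4,+}^{k}$ is bounded on the sequence $(a_m)$" means $\sup_m r_{4,+}^{k}(a_m)<\infty$. *)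

theory Defs
  imports Complex_Main "HOL-Computational_Algebra.Primes"
begin

section \<open>The ring of 2-adic integers\<close>

text \<open>
  The inverse limit of the rings of integers modulo \<open>2 ^ n\<close>: the \<open>n\<close>-th component of an element
  is its residue modulo \<open>2 ^ n\<close>, represented in \<open>{0..<2 ^ n}\<close>.
\<close>

typedef two_adic_int =
  "{x :: nat \<Rightarrow> int. (\<forall>n. x n \<in> {0..<2 ^ n}) \<and> (\<forall>n. x (Suc n) mod 2 ^ n = x n)}"
  morphisms residue Abs_two_adic_int
  by (rule exI[of _ "\<lambda>_. 0"]) simp

setup_lifting type_definition_two_adic_int

lemma residue_mod_Suc: "residue x (Suc n) mod 2 ^ n = residue x n"
  using residue[of x] by blast

lemma residue_mod_self [simp]: "residue x n mod 2 ^ n = residue x n"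
  using residue[of x] by (simp add: mod_pos_pos_trivial)

lemma residue_mod: "n \<le> m \<Longrightarrow> residue x m mod 2 ^ n = residue x n"
proof (induction m rule: dec_induct)
  case base
  show ?case by simp
next
  case (step m)
  have "residue x (Suc m) mod 2 ^ n = residue x (Suc m) mod 2 ^ m mod 2 ^ n"
    using step.hyps by (simp add: mod_mod_cancel le_imp_power_dvd)
  then show ?case
    using step.IH by (simp add: residue_mod_Suc)
qed

lemma residue_0_right [simp]: "residue x 0 = 0"
  using residue[of x] by (auto dest: spec[of _ 0])

lemma two_adic_int_eqI: "(\<And>n. residue x n = residue y n) \<Longrightarrow> x = y"
  by (metis ext residue_inject)

instantiation two_adic_int :: comm_ring_1
begin

lift_definition zero_two_adic_int :: two_adic_int is "\<lambda>_. 0" by simp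

lift_definition one_two_adic_int :: two_adic_int is "\<lambda>n. 1 mod 2 ^ n"
  by (auto simp: mod_mod_cancel le_imp_power_dvd simp del: power_Suc)

lift_definition plus_two_adic_int :: "two_adic_int \<Rightarrow> two_adic_int \<Rightarrow> two_adic_int"
  is "\<lambda>x y n. (x n + y n) mod 2 ^ n"
  by (auto simp: mod_mod_cancel le_imp_power_dvd simp del: power_Suc) (metis mod_add_eq)

lift_definition minus_two_adic_int :: "two_adic_int \<Rightarrow> two_adic_int \<Rightarrow> two_adic_int"
  is "\<lambda>x y n. (x n - y n) mod 2 ^ n"
  by (auto simp: mod_mod_cancel le_imp_power_dvd simp del: power_Suc) (metis mod_diff_eq)

lift_definition uminus_two_adic_int :: "two_adic_int \<Rightarrow> two_adic_int"
  is "\<lambda>x n. (- x n) mod 2 ^ n"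
  by (auto simp: mod_mod_cancel le_imp_power_dvd simp del: power_Suc) (metis mod_minus_eq)

lift_definition times_two_adic_int :: "two_adic_int \<Rightarrow> two_adic_int \<Rightarrow> two_adic_int"
  is "\<lambda>x y n. (x n * y n) mod 2 ^ n"
  by (auto simp: mod_mod_cancel le_imp_power_dvd simp del: power_Suc) (metis mod_mult_eq)

instance
proof
  fix a b c :: two_adic_int
  show "a * b * c = a * (b * c)"
    by transfer (simp add: fun_eq_iff mod_simps ac_simps)
  show "a * b = b * a"
    by transfer (simp add: mult.commute)
  show "1 * a = a"
    by (intro two_adic_int_eqI)
      (simp add: one_two_adic_int.rep_eq times_two_adic_int.rep_eq mod_mult_left_eq
        del: one_mod_2_pow_eq)
  show "a + b + c = a + (b + c)"
    by transfer (simp add: fun_eq_iff mod_simps ac_simps)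
  show "a + b = b + a"
    by transfer (simp add: add.commute)
  show "0 + a = a"
    by transfer (simp add: fun_eq_iff)
  show "- a + a = 0"
    by transfer (simp add: fun_eq_iff mod_simps)
  show "a - b = a + - b"
    by transfer (simp add: fun_eq_iff mod_simps)
  show "(a + b) * c = a * c + b * c"
    by transfer (simp add: fun_eq_iff mod_simps distrib_right)
  show "(0 :: two_adic_int) \<noteq> 1"
    by transfer (auto simp: fun_eq_iff intro!: exI[of _ 1])
qed

end

lemmas residue_simps = zero_two_adic_int.rep_eq one_two_adic_int.rep_eq plus_two_adic_int.rep_eq
  minus_two_adic_int.rep_eq uminus_two_adic_int.rep_eq times_two_adic_int.rep_eq

lemma nonzero_residue: "x \<noteq> 0 \<Longrightarrow> \<exists>n. residue x n \<noteq> 0"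
  using two_adic_int_eqI[of x 0] by (auto simp: residue_simps)

lemma residue_of_nat: "residue (of_nat m) n = int m mod 2 ^ n"
  by (induction m) (simp_all add: residue_simps mod_simps)

lemma residue_of_int: "residue (of_int m) n = m mod 2 ^ n"
  by (cases m rule: int_cases2) (simp_all add: residue_simps residue_of_nat mod_simps)

instantiation two_adic_int :: divide
begin

text \<open>The exact quotient where it exists in the ring, and \<open>0\<close> otherwise.\<close>

definition divide_two_adic_int :: "two_adic_int \<Rightarrow> two_adic_int \<Rightarrow> two_adic_int" where
  "divide_two_adic_int x y = (if y \<noteq> 0 \<and> y dvd x then THE z. x = z * y else 0)"

instance ..

end

instance two_adic_int :: idom_divide
proof
  fix a b :: two_adic_int
  show no_zero: "a * b \<noteq> 0" if nz: "a \<noteq> 0" "b \<noteq> 0" for a b :: two_adic_int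
  proof
    assume ab: "a * b = 0"
    obtain m n where m: "residue a m \<noteq> 0" and n: "residue b n \<noteq> 0"
      using nz nonzero_residue by blast
    have "residue (a * b) (m + n) = 0"
      using ab by (simp add: residue_simps)
    then have "2 ^ (m + n) dvd residue a (m + n) * residue b (m + n)"
      by (simp add: residue_simps mod_eq_0_iff_dvd)
    moreover have "\<not> 2 ^ m dvd residue a (m + n)" "\<not> 2 ^ n dvd residue b (m + n)"
      using m n residue_mod[of m "m + n" a] residue_mod[of n "m + n" b]
      by (auto simp: dvd_eq_mod_eq_0)
    moreover have "prime_elem (2 :: int)" by simp
    ultimately obtain i j where "i + j = m + n"
      "2 ^ i dvd residue a (m + n)" "2 ^ j dvd residue b (m + n)"
      using prime_elem_power_dvd_prod by meson
    moreover from this(1) have "m \<le> i \<or> n \<le> j" by linarith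
    ultimately show False
      using \<open>\<not> 2 ^ m dvd _\<close> \<open>\<not> 2 ^ n dvd _\<close> by (meson power_le_dvd)
  qed
  show "a * b div b = a" if "b \<noteq> 0"
  proof -
    have "z = a" if "a * b = z * b" for z
    proof -
      have "(a - z) * b = 0" using that by (simp add: left_diff_distrib)
      with no_zero \<open>b \<noteq> 0\<close> show ?thesis by (metis eq_iff_diff_eq_0)
    qed
    then have "(THE z. a * b = z * b) = a" by (intro the_equality) auto
    with that show ?thesis by (simp add: divide_two_adic_int_def)
  qed
  show "a div 0 = 0" by (simp add: divide_two_adic_int_def)
qed

text \<open>
  The 2-adic absolute value \<open>2 ^ (- v)\<close>, where \<open>v\<close> is the largest exponent such that \<open>x\<close> vanishes
  modulo \<open>2 ^ v\<close>, that is, the least \<open>v\<close> such that \<open>x\<close> does not vanish modulo \<open>2 ^ (v + 1)\<close>.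
\<close>

definition two_adic_abs :: "two_adic_int \<Rightarrow> real" where
  "two_adic_abs x = (if x = 0 then 0 else (1 / 2) ^ (LEAST v. residue x (Suc v) \<noteq> 0))"

lemma two_adic_abs_le_iff: "two_adic_abs x \<le> (1 / 2) ^ n \<longleftrightarrow> residue x n = 0"
proof (cases "x = 0")
  case True
  then show ?thesis by (simp add: two_adic_abs_def residue_simps)
next
  case False
  define v where "v = (LEAST v. residue x (Suc v) \<noteq> 0)"
  obtain m where "residue x m \<noteq> 0"
    using False nonzero_residue by blast
  then obtain v' where "residue x (Suc v') \<noteq> 0"
    by (cases m) auto
  then have v: "residue x (Suc v) \<noteq> 0"
    unfolding v_def by (rule LeastI)
  have v_le: "v \<le> w" if "residue x (Suc w) \<noteq> 0" for w
    unfolding v_def using that by (rule Least_le)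
  have "residue x n = 0 \<longleftrightarrow> n \<le> v"
  proof
    assume "residue x n = 0"
    then show "n \<le> v"
      using v residue_mod[of "Suc v" n x] by (metis mod_0 not_less_eq_eq)
  next
    assume "n \<le> v"
    then show "residue x n = 0"
      using v_le by (cases n) force+
  qed
  moreover have "two_adic_abs x = (1 / 2) ^ v"
    using False by (simp add: two_adic_abs_def v_def)
  ultimately show ?thesis
    by (simp add: power_decreasing_iff)
qed

lemma two_adic_abs_nonneg: "0 \<le> two_adic_abs x"
  by (simp add: two_adic_abs_def)

lemma two_adic_abs_eq_0_iff: "two_adic_abs x = 0 \<longleftrightarrow> x = 0"
  by (simp add: two_adic_abs_def)

lemma two_adic_abs_add_le: "two_adic_abs (x + y) \<le> max (two_adic_abs x) (two_adic_abs y)"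
proof (cases "x = 0 \<and> y = 0")
  case True
  then show ?thesis by simp
next
  case False
  have pow: "\<exists>n. two_adic_abs z = (1 / 2) ^ n" if "z \<noteq> 0" for z
    using that by (auto simp: two_adic_abs_def)
  have "max (two_adic_abs x) (two_adic_abs y) > 0"
    using False by (auto simp: two_adic_abs_def less_max_iff_disj)
  then obtain n where n: "max (two_adic_abs x) (two_adic_abs y) = (1 / 2) ^ n"
    using pow by (metis max_def order_less_irrefl two_adic_abs_eq_0_iff)
  then have "residue x n = 0" "residue y n = 0"
    by (metis max.cobounded1 max.cobounded2 two_adic_abs_le_iff)+
  then have "residue (x + y) n = 0"
    by (simp add: residue_simps)
  with n show ?thesis
    by (simp add: two_adic_abs_le_iff)
qed

lemma two_adic_abs_minus: "two_adic_abs (x - y) = two_adic_abs (y - x)"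
proof -
  have "residue (x - y) n = 0 \<longleftrightarrow> residue (y - x) n = 0" for n
    by (simp add: residue_simps mod_eq_0_iff_dvd dvd_diff_commute)
  moreover have "x - y = 0 \<longleftrightarrow> y - x = 0" by auto
  ultimately show ?thesis
    unfolding two_adic_abs_def by presburger
qed

instantiation two_adic_int :: metric_space
begin

definition dist_two_adic_int :: "two_adic_int \<Rightarrow> two_adic_int \<Rightarrow> real" where
  "dist_two_adic_int x y = two_adic_abs (x - y)"

definition uniformity_two_adic_int :: "(two_adic_int \<times> two_adic_int) filter" where
  "uniformity_two_adic_int = (INF e\<in>{0 <..}. principal {(x, y). dist x y < e})"

definition open_two_adic_int :: "two_adic_int set \<Rightarrow> bool" where
  "open_two_adic_int U \<longleftrightarrow> (\<forall>x\<in>U. \<forall>\<^sub>F (x', y) in uniformity. x' = x \<longrightarrow> y \<in> U)"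

instance
proof
  fix x y z :: two_adic_int
  show "dist x y = 0 \<longleftrightarrow> x = y"
    by (simp add: dist_two_adic_int_def two_adic_abs_eq_0_iff)
  show "dist x y \<le> dist x z + dist y z"
    using two_adic_abs_add_le[of "x - z" "z - y"] two_adic_abs_minus[of z y]
      two_adic_abs_nonneg[of "x - z"] two_adic_abs_nonneg[of "y - z"]
    by (simp add: dist_two_adic_int_def)
qed (fact uniformity_two_adic_int_def open_two_adic_int_def)+

end


section \<open>Sums of four polygonal numbers\<close>

text \<open>The division is exact, see \<open>two_polygonal\<close>.\<close>

definition polygonal :: "int \<Rightarrow> int \<Rightarrow> int" where
  "polygonal k x = ((k - 2) * x ^ 2 - (k - 4) * x) div 2"

lemma two_polygonal: "2 * polygonal k x = (k - 2) * x ^ 2 - (k - 4) * x"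
proof -
  have "even ((k - 2) * x ^ 2 - (k - 4) * x)" by auto
  then show ?thesis unfolding polygonal_def by (rule dvd_mult_div_cancel)
qed

definition representations4 :: "int \<Rightarrow> nat \<Rightarrow> (nat \<times> nat \<times> nat \<times> nat) set" where
  "representations4 k N =
     {(x\<^sub>1, x\<^sub>2, x\<^sub>3, x\<^sub>4). polygonal k (int x\<^sub>1) + polygonal k (int x\<^sub>2)
        + polygonal k (int x\<^sub>3) + polygonal k (int x\<^sub>4) = int N}"

definition r4 :: "int \<Rightarrow> nat \<Rightarrow> nat" where
  "r4 k N = card (representations4 k N)"

text \<open>The set being counted is finite, so that \<open>card\<close> is the actual number of representations.\<close>

lemma polygonal_ge: "polygonal k (int x) \<ge> int x" if "k \<ge> 3"
proof -
  have "0 \<le> (k - 2) * (int x * (int x - 1))"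
    using that by (cases x) auto
  then have "2 * polygonal k (int x) \<ge> 2 * int x"
    unfolding two_polygonal by (simp add: power2_eq_square algebra_simps)
  then show ?thesis by simp
qed

lemma finite_representations4: "finite (representations4 k N)" if "k \<ge> 3"
proof (rule finite_subset)
  show "representations4 k N \<subseteq> {..N} \<times> {..N} \<times> {..N} \<times> {..N}"
  proof (clarsimp simp: representations4_def)
    fix a b c d :: nat
    assume "polygonal k (int a) + polygonal k (int b) + polygonal k (int c)
      + polygonal k (int d) = int N"
    then show "a \<le> N \<and> b \<le> N \<and> c \<le> N \<and> d \<le> N"
      using polygonal_ge[OF that, of a] polygonal_ge[OF that, of b]
        polygonal_ge[OF that, of c] polygonal_ge[OF that, of d] by linarith
  qed
qed simp

definition r4_bounded_on :: "int \<Rightarrow> (nat \<Rightarrow> nat) \<Rightarrow> bool" where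
  "r4_bounded_on k a \<longleftrightarrow> bdd_above (range (\<lambda>m. r4 k (a m)))"

end

theory Submission
  imports Defs "HOL-Number_Theory.Quadratic_Reciprocity" "HOL-Computational_Algebra.Squarefree"
begin

text \<open>
  Put \<open>m = k - 2\<close>. Four nonnegative integers with sum \<open>b\<close> and sum of squares \<open>a\<close> have \<open>k\<close>-gonal numbers
  that add up to \<open>N\<close> exactly when \<open>m (a - b) = 2 (N - b)\<close>, and different \<open>b\<close> give different
  representations. By Cauchy's lemma \<open>cauchy_four_squares\<close>, a pair \<open>(a, b)\<close> of equal parity arises in this
  way if \<open>b \<ge> 0\<close>, \<open>3 a \<le> b\<^sup>2\<close> and \<open>4 a - b\<^sup>2\<close> is a sum of three squares. The inequalities
  \<open>3 a \<le> b\<^sup>2 < 4 a\<close> hold for all \<open>b\<close> in an interval whose length grows like \<open>sqrt N\<close>. So the number of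
  representations tends to infinity along those \<open>N\<close> for which some residue class of \<open>b\<close>, to a modulus
  that stays bounded, makes \<open>4 a - b\<^sup>2\<close> a power of 4 times a number that is 1 or 2 modulo 4 or 3
  modulo 8; such numbers are sums of three squares.

  If \<open>k\<close> or \<open>N\<close> is odd, odd \<open>b\<close> make \<open>4 a - b\<^sup>2\<close> equal to 3 modulo 8. If \<open>k\<close> is 2 modulo 4 and \<open>N\<close> is even,
  \<open>a\<close> can be made 2 modulo 4. If \<open>k\<close> is divisible by 4 and \<open>N\<close> is even, write \<open>m = 2 \<mu>\<close> with \<open>\<mu>\<close> odd; then
  \<open>\<mu>\<^sup>2 (a - (b / 2)\<^sup>2) = M - c\<^sup>2\<close> with \<open>M = \<mu> N + (\<mu> - 1)\<^sup>2\<close> and \<open>c\<close> free modulo powers of 2, and a good class of \<open>c\<close>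
  exists whose modulus depends on the power of 4 in \<open>M\<close>. So a large \<open>N\<close> can have few representations only if \<open>M\<close> is
  divisible by a high power of 2, that is, if \<open>N\<close> is 2-adically close to
  \<open>- (\<mu> - 1)\<^sup>2 / \<mu> = (k - 4)\<^sup>2 / (4 - 2 k)\<close>.

  The theorem on three squares rests on Gauss's criterion \<open>sum_of_three_squares_criterion\<close>: \<open>n\<close> is a sum of
  three squares if some \<open>a > 0\<close> coprime to \<open>n\<close> has the property that \<open>- a\<close> is a square modulo \<open>n\<close> and \<open>- n\<close> is
  a square modulo \<open>a\<close>, because \<open>n\<close> is then a value of a positive ternary form of determinant 1. To find \<open>a\<close>
  one usually takes a prime in an arithmetic progression. An average does as well, in
  \<open>exists_prescribed_characters\<close>: let \<open>\<chi>\<close> be the character with \<open>\<chi> l = 1\<close> exactly when \<open>- n\<close> is a square modulo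
  the prime \<open>l\<close>, for \<open>l\<close> not dividing \<open>2 n\<close>. The divisor sums \<open>\<rho> q = (\<Sum>d | d dvd q. \<chi> d)\<close> are nonnegative, and
  for \<open>q\<close> coprime to \<open>2 n\<close> with \<open>\<rho> q > 0\<close> the squarefree part of \<open>q\<close> is a product of primes \<open>l\<close> with \<open>\<chi> l = 1\<close>.
  The sum of \<open>\<rho> q / sqrt q\<close> over these \<open>q\<close> diverges, by the contribution of the squares alone, whereas its
  twists by nontrivial products of independent Legendre symbols stay bounded by the hyperbola method. Hence
  the Legendre symbols of \<open>q\<close> can be prescribed.
\<close>

section \<open>Positive ternary forms of determinant 1\<close>

lemma exists_balanced_shift:
  fixes a b :: int
  assumes "a > 0"
  shows "\<exists>t. 2 * \<bar>b + a * t\<bar> \<le> a"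
proof -
  define t where "t = - ((2 * b + a) div (2 * a))"
  have "(2 * b + a) = (2 * a) * ((2 * b + a) div (2 * a)) + (2 * b + a) mod (2 * a)"
    by simp
  moreover have "0 \<le> (2 * b + a) mod (2 * a)" "(2 * b + a) mod (2 * a) < 2 * a"
    using assms by simp_all
  ultimately have "2 * (b + a * t) \<le> a" "- a \<le> 2 * (b + a * t)"
    unfolding t_def by (simp_all add: algebra_simps)
  then have "2 * \<bar>b + a * t\<bar> \<le> a" by linarith
  then show ?thesis by blast
qed

text \<open>
  The form has the integral matrix with rows \<open>(a, f, e)\<close>, \<open>(f, b, d)\<close>, \<open>(e, d, c)\<close>. The four
  lemmas that follow are elementary unimodular substitutions, the steps of the reduction below.
\<close>

definition sum3sq_form :: "int \<Rightarrow> int \<Rightarrow> int \<Rightarrow> int \<Rightarrow> int \<Rightarrow> int \<Rightarrow> bool" where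
  "sum3sq_form a b c d e f \<longleftrightarrow> (\<forall>x y z. \<exists>u v w.
     a*x^2 + b*y^2 + c*z^2 + 2*d*y*z + 2*e*x*z + 2*f*x*y = u^2 + v^2 + w^2)"

lemma sum3sq_form_shift_yz:
  assumes "sum3sq_form a b (b*t^2 + 2*d*t + c) (d + b*t) (e + f*t) f"
  shows "sum3sq_form a b c d e f"
  unfolding sum3sq_form_def
proof (intro allI)
  fix x y z
  show "\<exists>u v w. a*x^2 + b*y^2 + c*z^2 + 2*d*y*z + 2*e*x*z + 2*f*x*y = u^2 + v^2 + w^2"
    using assms[unfolded sum3sq_form_def, rule_format, of x "y - t*z" z]
    by (simp add: power2_eq_square algebra_simps)
qed

lemma sum3sq_form_shift_xy:
  assumes "sum3sq_form a (a*t^2 + 2*f*t + b) c (d + e*t) e (f + a*t)"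
  shows "sum3sq_form a b c d e f"
  unfolding sum3sq_form_def
proof (intro allI)
  fix x y z
  show "\<exists>u v w. a*x^2 + b*y^2 + c*z^2 + 2*d*y*z + 2*e*x*z + 2*f*x*y = u^2 + v^2 + w^2"
    using assms[unfolded sum3sq_form_def, rule_format, of "x - t*y" y z]
    by (simp add: power2_eq_square algebra_simps)
qed

lemma sum3sq_form_swap_yz:
  assumes "sum3sq_form a c b d f e"
  shows "sum3sq_form a b c d e f"
  unfolding sum3sq_form_def
proof (intro allI)
  fix x y z
  show "\<exists>u v w. a*x^2 + b*y^2 + c*z^2 + 2*d*y*z + 2*e*x*z + 2*f*x*y = u^2 + v^2 + w^2"
    using assms[unfolded sum3sq_form_def, rule_format, of x z y] by (simp add: algebra_simps)
qed

lemma sum3sq_form_swap_xy: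
  assumes "sum3sq_form b a c e d f"
  shows "sum3sq_form a b c d e f"
  unfolding sum3sq_form_def
proof (intro allI)
  fix x y z
  show "\<exists>u v w. a*x^2 + b*y^2 + c*z^2 + 2*d*y*z + 2*e*x*z + 2*f*x*y = u^2 + v^2 + w^2"
    using assms[unfolded sum3sq_form_def, rule_format, of y x z] by (simp add: algebra_simps)
qed

text \<open>
  Hermite's reduction. Completing the square gives
  \<open>a Q = (a x + f y + e z)\<^sup>2 + (A y\<^sup>2 + 2 B y z + C z\<^sup>2)\<close> with \<open>A = a b - f\<^sup>2\<close>, \<open>B = a d - e f\<close>,
  \<open>C = a c - e\<^sup>2\<close>, and \<open>A C - B\<^sup>2 = a\<close> because the determinant is 1. Shifting \<open>y\<close> by a multiple of \<open>z\<close>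
  makes \<open>2 \<bar>B\<bar> \<le> A\<close> and shifting \<open>x\<close> by a multiple of \<open>y\<close> makes \<open>2 \<bar>f\<bar> \<le> a\<close>. After that, swapping two
  variables decreases the pair \<open>(a, A)\<close> lexicographically unless \<open>A \<le> C\<close> and \<open>a \<le> b\<close>, and then
  \<open>3 A\<^sup>2 \<le> 4 a\<close> and \<open>3 a\<^sup>2 \<le> 4 A\<close>, so \<open>a = A = 1\<close> and the form is visibly a sum of three squares.
\<close>

lemma unimodular_ternary_form:
  fixes a b c d e f :: int
  assumes "a > 0" "a*b - f^2 > 0" "a*b*c + 2*d*e*f - a*d^2 - b*e^2 - c*f^2 = 1"
  shows "sum3sq_form a b c d e f"
proof -
  have "\<forall>a b c d e f. nat a = n \<and> nat (a*b - f^2) = l \<and> a > 0 \<and> a*b - f^2 > 0 \<and>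
    a*b*c + 2*d*e*f - a*d^2 - b*e^2 - c*f^2 = 1 \<longrightarrow> sum3sq_form a b c d e f" for n l
  proof (induction n arbitrary: l rule: less_induct)
    case (less n)
    note IH1 = less.IH
    show ?case
    proof (induction l rule: less_induct)
      case (less l)
      note IH2 = less.IH
      show ?case
      proof (intro allI impI, elim conjE)
        fix a b c d e f :: int
        assume n: "nat a = n" and l: "nat (a*b - f^2) = l" and a: "a > 0" and A: "a*b - f^2 > 0"
          and det: "a*b*c + 2*d*e*f - a*d^2 - b*e^2 - c*f^2 = 1"
        define A where "A = a*b - f^2"
        have red: "sum3sq_form a b c d e f"
          if a: "a > 0" and A: "A = a*b - f^2" "A > 0" and n: "nat a = n" and l: "nat A = l"
          and det: "a*b*c + 2*d*e*f - a*d^2 - b*e^2 - c*f^2 = 1"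
          and B: "2 * \<bar>a*d - e*f\<bar> \<le> A" and f: "2 * \<bar>f\<bar> \<le> a"
          for a b c d e f A :: int
        proof -
          define B C where "B = a*d - e*f" and "C = a*c - e^2"
          have "A*C - B^2 = a * (a*b*c + 2*d*e*f - a*d^2 - b*e^2 - c*f^2)"
            unfolding A B_def C_def by (simp add: power2_eq_square algebra_simps)
          then have disc: "A*C - B^2 = a" using det by simp
          then have "A * C > 0" using a zero_le_power2[of B] by linarith
          then have C: "C > 0" using A(2) by (simp add: zero_less_mult_iff)
          have "a * b > 0" using A zero_le_power2[of f] by linarith
          then have b: "b > 0" using a by (simp add: zero_less_mult_iff)
          consider "C < A" | "b < a" | "A \<le> C" "a \<le> b" by linarith
          then show ?thesis
          proof cases
            case 1
            show ?thesis
            proof (rule sum3sq_form_swap_yz)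
              have "nat C < l" using 1 C l by linarith
              then show "sum3sq_form a c b d f e"
                using IH2[of "nat C"] a C det n unfolding C_def by (auto simp: algebra_simps)
            qed
          next
            case 2
            have "nat b < n" using 2 b n by linarith
            then have "sum3sq_form b a c e d f"
              using IH1[of "nat b" "nat A"] b A det by (auto simp: algebra_simps)
            then show ?thesis by (rule sum3sq_form_swap_xy)
          next
            case 3
            \<comment> \<open>both the binary form and the first two variables are reduced\<close>
            have "A * A \<le> A * C" using 3 A by simp
            moreover have "(2 * \<bar>B\<bar>)^2 \<le> A^2"
              using B unfolding B_def by (intro power_mono) auto
            ultimately have 1: "3 * A^2 \<le> 4 * a" using disc by (simp add: power2_eq_square)
            have "a * a \<le> a * b" using 3 a by simp
            moreover have "(2 * \<bar>f\<bar>)^2 \<le> a^2"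
              using f by (intro power_mono) auto
            ultimately have 2: "3 * a^2 \<le> 4 * A" using A by (simp add: power2_eq_square)
            have a1: "a = 1"
            proof (rule ccontr)
              assume "a \<noteq> 1"
              then have a2: "a \<ge> 2" using a by simp
              have "A < a"
              proof (rule ccontr)
                assume "\<not> A < a"
                then have "a \<le> A" by simp
                then have "a * A \<le> A * A" using A by simp
                moreover have "2 * A \<le> a * A" using a2 A(2) by (intro mult_right_mono) auto
                ultimately show False using 1 \<open>a \<le> A\<close> A(2) unfolding power2_eq_square by linarith
              qed
              moreover have "2 * a \<le> a * a" using a2 by simp
              ultimately show False using 2 a unfolding power2_eq_square by linarith
            qed
            have A1: "A = 1"
            proof (rule ccontr)
              assume "A \<noteq> 1"
              then have "A \<ge> 2" using A by simp
              then have "2 * A \<le> A * A" by simp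
              then show False using 1 a1 \<open>A \<ge> 2\<close> unfolding power2_eq_square by linarith
            qed
            have f0: "f = 0" using f a1 by linarith
            have b1: "b = 1" using A A1 a1 f0 by simp
            have d0: "d = 0" using B a1 f0 A1 by simp
            have c: "c = 1 + e^2" using det a1 b1 d0 f0 by simp
            have "\<exists>u v w. a*x^2 + b*y^2 + c*z^2 + 2*d*y*z + 2*e*x*z + 2*f*x*y = u^2 + v^2 + w^2" for x y z
              by (rule exI[of _ "x + e*z"], rule exI[of _ y], rule exI[of _ z])
                (simp add: a1 b1 c d0 f0 power2_eq_square algebra_simps)
            then show ?thesis unfolding sum3sq_form_def by blast
          qed
        qed
        obtain t where t: "2 * \<bar>(a*d - e*f) + A*t\<bar> \<le> A"
          using exists_balanced_shift[of A "a*d - e*f"] A unfolding A_def by blast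
        obtain s where s: "2 * \<bar>f + a*s\<bar> \<le> a"
          using exists_balanced_shift[OF a] by blast
        show "sum3sq_form a b c d e f"
        proof (rule sum3sq_form_shift_yz[of a b t], rule sum3sq_form_shift_xy[of a s], rule red[of a A])
          show "A = a * (a*s^2 + 2*f*s + b) - (f + a*s)^2" unfolding A_def
            by (simp add: power2_eq_square algebra_simps)
          have "a*(d + b*t + (e + f*t)*s) - (e + f*t)*(f + a*s) = (a*d - e*f) + A*t"
            unfolding A_def by (simp add: power2_eq_square algebra_simps)
          then show "2 * \<bar>a*(d + b*t + (e + f*t)*s) - (e + f*t)*(f + a*s)\<bar> \<le> A"
            using t by simp
          have "a*(a*s^2 + 2*f*s + b)*(b*t^2 + 2*d*t + c) + 2*(d + b*t + (e + f*t)*s)*(e + f*t)*(f + a*s)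
            - a*(d + b*t + (e + f*t)*s)^2 - (a*s^2 + 2*f*s + b)*(e + f*t)^2 - (b*t^2 + 2*d*t + c)*(f + a*s)^2
            = a*b*c + 2*d*e*f - a*d^2 - b*e^2 - c*f^2"
            by (simp add: power2_eq_square algebra_simps)
          then show "a*(a*s^2 + 2*f*s + b)*(b*t^2 + 2*d*t + c) + 2*(d + b*t + (e + f*t)*s)*(e + f*t)*(f + a*s)
            - a*(d + b*t + (e + f*t)*s)^2 - (a*s^2 + 2*f*s + b)*(e + f*t)^2 - (b*t^2 + 2*d*t + c)*(f + a*s)^2 = 1"
            using det by simp
        qed (use a A n l s in \<open>auto simp: A_def\<close>)
      qed
    qed
  qed
  then show ?thesis using assms by blast
qed

text \<open>
  Gauss's criterion. The binary form \<open>a y\<^sup>2 + 2 s y z + c z\<^sup>2\<close> with \<open>a c - s\<^sup>2 = n\<close> is, modulo \<open>n\<close>, minus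
  the square of a linear form \<open>B y + C z\<close>. Hence
  \<open>((n x + B y + C z)\<^sup>2 + a y\<^sup>2 + 2 s y z + c z\<^sup>2) / n\<close> has integral matrix, determinant 1, and the
  value \<open>n\<close> at \<open>(1, 0, 0)\<close>.
\<close>

lemma sum_of_three_squares_criterion:
  fixes n a B s :: int
  assumes n: "n > 0" and a: "a > 0" and cop: "coprime a n"
    and B: "n dvd B^2 + a" and s: "a dvd s^2 + n"
  shows "\<exists>u v w :: int. n = u^2 + v^2 + w^2"
proof -
  obtain c where c: "s^2 + n = a * c" using s by (elim dvdE)
  obtain a' where a': "[a * a' = 1] (mod n)"
    using cop cong_solve_coprime_int by blast
  then obtain h where h: "a * a' = 1 + n * h"
    by (metis cong_iff_lin cong_sym)
  obtain k where k: "B^2 + a = n * k" using B by (elim dvdE)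
  \<comment> \<open>forced by \<open>a C \<equiv> - B\<^sup>2 C \<equiv> B s\<close> modulo \<open>n\<close>\<close>
  define C where "C = B * s * a'"
  have "s + B*C = s + B^2 * (s * a')"
    by (simp add: C_def power2_eq_square)
  also have "B^2 = n*k - a" using k by simp
  also have "s + (n*k - a) * (s * a') = s + n*k*s*a' - s*(a * a')"
    by (simp add: algebra_simps)
  also have "\<dots> = n * (k * s * a' - h * s)"
    using h by (simp add: algebra_simps)
  finally obtain l where l: "s + B*C = n * l" by blast
  have "c + C^2 = c + (n*k - a) * (a * c - n) * a'^2"
  proof -
    have "C^2 = B^2 * s^2 * a'^2" by (simp add: C_def power_mult_distrib)
    moreover have "B^2 = n*k - a" "s^2 = a*c - n" using k c by auto
    ultimately show ?thesis by simp
  qed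
  also have "\<dots> = c - c * (a * a')^2 + n * (k * (a * c - n) * a'^2 + a * a'^2)"
    by (simp add: power2_eq_square algebra_simps)
  also have "\<dots> = n * (- c * (2 * h + n * h^2) + (k * (a * c - n) * a'^2 + a * a'^2))"
    unfolding h by (simp add: power2_eq_square algebra_simps)
  finally obtain m where m: "c + C^2 = n * m" by blast
  have "n * (n*k*m + 2*l*C*B - n*l^2 - k*C^2 - m*B^2) = n"
  proof -
    have "n * (n*k*m + 2*l*C*B - n*l^2 - k*C^2 - m*B^2)
        = (n*k) * (n*m) + 2*(n*l)*C*B - (n*l)^2 - (n*k)*C^2 - (n*m)*B^2"
      by (simp add: power2_eq_square algebra_simps)
    also have "\<dots> = (B^2+a)*(c+C^2) + 2*(s+B*C)*C*B - (s+B*C)^2 - (B^2+a)*C^2 - (c+C^2)*B^2"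
      using k l m by simp
    also have "\<dots> = a*c - s^2" by (simp add: power2_eq_square algebra_simps)
    finally show ?thesis using c by simp
  qed
  then have det: "n*k*m + 2*l*C*B - n*l^2 - k*C^2 - m*B^2 = 1" using n by simp
  have "n*k - B^2 = a" using k by simp
  then have "sum3sq_form n k m l C B"
    using unimodular_ternary_form[OF n _ det] a by simp
  from this[unfolded sum3sq_form_def, rule_format, of 1 0 0] show ?thesis by simp
qed

section \<open>Real characters and the hyperbola method\<close>

text \<open>
  Dirichlet characters modulo \<open>m\<close> with real values, extended by 0 to the residues that are not units.
\<close>

definition real_char :: "nat \<Rightarrow> (nat \<Rightarrow> int) \<Rightarrow> bool" where
  "real_char m f \<longleftrightarrow> m > 0 \<and> (\<forall>x y. f (x * y) = f x * f y) \<and> (\<forall>x. f (x + m) = f x) \<and>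
     (\<forall>x. f x \<in> {-1, 0, 1}) \<and> (\<forall>x. f x \<noteq> 0 \<longleftrightarrow> coprime x m)"

lemma real_charD:
  assumes "real_char m f"
  shows "m > 0" "f (x * y) = f x * f y" "f (x + m) = f x" "f x \<in> {-1, 0, 1}"
    "f x \<noteq> 0 \<longleftrightarrow> coprime x m"
  using assms unfolding real_char_def by blast+

lemma real_char_mod: "real_char m f \<Longrightarrow> f (x mod m) = f x"
proof -
  assume f: "real_char m f"
  have "f (y + m * k) = f y" for y k
  proof (induction k)
    case (Suc k)
    have "f (y + m * k + m) = f (y + m * k)" by (rule real_charD(3)[OF f])
    then show ?case using Suc by (simp add: ac_simps)
  qed simp
  from this[of "x mod m" "x div m"] show ?thesis by simp
qed

lemma real_char_cong: "real_char m f \<Longrightarrow> [x = y] (mod m) \<Longrightarrow> f x = f y"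
  by (metis real_char_mod cong_def)

lemma real_char_1: "real_char m f \<Longrightarrow> f 1 = 1"
  using real_charD(2)[of m f 1 1] real_charD(4)[of m f 1] real_charD(5)[of m f 1] by auto

lemma real_char_unit: "real_char m f \<Longrightarrow> coprime x m \<Longrightarrow> f x = 1 \<or> f x = -1"
  using real_charD(4)[of m f x] real_charD(5)[of m f x] by auto

lemma real_char_power: "real_char m f \<Longrightarrow> f (x ^ k) = f x ^ k"
  using real_charD(2)[of m f] real_char_1[of m f] by (induction k) auto

lemma real_char_mult: "real_char m f \<Longrightarrow> real_char m g \<Longrightarrow> real_char m (\<lambda>x. f x * g x)"
proof -
  assume f: "real_char m f" and g: "real_char m g"
  have "f x * g x \<in> {-1, 0, 1}" for x
    using real_charD(4)[OF f, of x] real_charD(4)[OF g, of x] by auto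
  then show ?thesis using f g unfolding real_char_def by simp
qed

lemma real_char_principal: "m > 0 \<Longrightarrow> real_char m (\<lambda>x. of_bool (coprime x m))"
proof -
  assume "m > 0"
  moreover have "coprime (x + m) m \<longleftrightarrow> coprime x m" for x :: nat
    by (simp only: coprime_iff_gcd_eq_1 gcd_add1)
  ultimately show ?thesis unfolding real_char_def by auto
qed

lemma real_char_prod:
  assumes "finite A" "m > 0" "\<And>j. j \<in> A \<Longrightarrow> real_char m (\<psi> j)"
  shows "real_char m (\<lambda>x. of_bool (coprime x m) * (\<Prod>j\<in>A. \<psi> j x))"
  using assms
proof (induction A rule: finite_induct)
  case empty
  then show ?case using real_char_principal[of m] by simp
next
  case (insert j A)
  have "real_char m (\<lambda>x. \<psi> j x * (of_bool (coprime x m) * (\<Prod>j\<in>A. \<psi> j x)))"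
    using insert by (intro real_char_mult[of m "\<psi> j" "\<lambda>x. of_bool (coprime x m) * (\<Prod>j\<in>A. \<psi> j x)"]) auto
  then show ?case using insert.hyps by (simp add: ac_simps)
qed

lemma real_char_sum_period:
  assumes f: "real_char m f" and a: "f a = -1"
  shows "(\<Sum>x<m. f x) = 0"
proof -
  have cop: "coprime a m" using real_charD(5)[OF f, of a] a by simp
  have m: "m > 0" by (rule real_charD(1)[OF f])
  have inj: "inj_on (\<lambda>x. a * x mod m) {..<m}"
  proof (rule inj_onI)
    fix x y assume "x \<in> {..<m}" "y \<in> {..<m}" "a * x mod m = a * y mod m"
    then have "[x = y] (mod m)" using cop cong_mult_lcancel_nat[of a m x y] by (simp add: cong_def)
    then show "x = y" using \<open>x \<in> _\<close> \<open>y \<in> _\<close> by (simp add: cong_def)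
  qed
  moreover have "(\<lambda>x. a * x mod m) ` {..<m} \<subseteq> {..<m}" using m by auto
  ultimately have bij: "bij_betw (\<lambda>x. a * x mod m) {..<m} {..<m}"
    by (simp add: bij_betw_def endo_inj_surj)
  have "(\<Sum>x<m. f x) = (\<Sum>x<m. f (a * x mod m))"
    by (rule sum.reindex_bij_betw[OF bij, symmetric])
  also have "\<dots> = (\<Sum>x<m. - f x)"
    by (intro sum.cong refl) (simp add: real_char_mod[OF f] real_charD(2)[OF f] a)
  also have "\<dots> = - (\<Sum>x<m. f x)" by (simp add: sum_negf)
  finally show ?thesis by simp
qed

text \<open>
  A character that takes the value \<open>-1\<close> sums to 0 over each period, so an interval reduces to one that
  is shorter than a period.
\<close>

lemma real_char_sum_interval:
  assumes f: "real_char m f" and a: "f a = -1"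
  shows "\<bar>\<Sum>x\<in>{u..<v}. f x\<bar> \<le> int m"
proof -
  have win: "(\<Sum>x\<in>{n..<n+m}. f x) = 0" for n
  proof (induction n)
    case 0
    then show ?case using real_char_sum_period[OF assms] by (simp add: atLeast0LessThan)
  next
    case (Suc n)
    have "(\<Sum>x\<in>{n..<Suc n+m}. f x) = f n + (\<Sum>x\<in>{Suc n..<Suc n+m}. f x)"
      by (rule sum.atLeast_Suc_lessThan) simp
    moreover have "(\<Sum>x\<in>{n..<Suc n+m}. f x) = (\<Sum>x\<in>{n..<n+m}. f x) + f (n + m)"
      by simp
    ultimately show ?case using Suc real_charD(3)[OF f, of n] by simp
  qed
  have m: "m > 0" by (rule real_charD(1)[OF f])
  show ?thesis
  proof (induction "v - u" arbitrary: u rule: less_induct)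
    case less
    show ?case
    proof (cases "u + m \<le> v")
      case True
      have "(\<Sum>x\<in>{u..<v}. f x) = (\<Sum>x\<in>{u..<u+m}. f x) + (\<Sum>x\<in>{u+m..<v}. f x)"
        using True by (simp add: sum.atLeastLessThan_concat)
      then show ?thesis using win[of u] less[of "u + m"] True m by simp
    next
      case False
      have "\<bar>\<Sum>x\<in>{u..<v}. f x\<bar> \<le> (\<Sum>x\<in>{u..<v}. \<bar>f x\<bar>)" by (rule sum_abs)
      also have "\<dots> \<le> (\<Sum>x\<in>{u..<v}. 1)"
      proof (rule sum_mono)
        fix x show "\<bar>f x\<bar> \<le> 1" using real_charD(4)[OF f, of x] by auto
      qed
      also have "\<dots> \<le> int m" using False by simp
      finally show ?thesis .
    qed
  qed
qed

text \<open>
  Abel's summation by parts against a decreasing weight. It makes the tails of the series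
  \<open>\<Sum> f x / sqrt x\<close> small when \<open>f\<close> has bounded partial sums.
\<close>

lemma abel_summation_bound:
  fixes g w :: "nat \<Rightarrow> real"
  assumes G: "\<And>v. \<bar>\<Sum>x\<in>{u..<v}. g x\<bar> \<le> B"
    and dec: "\<And>x. u \<le> x \<Longrightarrow> w (Suc x) \<le> w x" and pos: "\<And>x. u \<le> x \<Longrightarrow> 0 \<le> w x"
  shows "\<bar>\<Sum>x\<in>{u..<v}. g x * w x\<bar> \<le> B * w u"
proof (cases "u \<le> v")
  case False
  have "0 \<le> B" using G[of u] by simp
  then show ?thesis using False pos[of u] by simp
next
  case True
  define H where "H v = (\<Sum>x\<in>{u..<v}. g x)" for v
  have eq: "(\<Sum>x\<in>{u..<v}. g x * w x) = (\<Sum>x\<in>{u..<v}. H (Suc x) * (w x - w (Suc x))) + H v * w v"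
    using True
  proof (induction v rule: dec_induct)
    case base
    then show ?case by (simp add: H_def)
  next
    case (step v)
    have "H (Suc v) = H v + g v" using step.hyps by (simp add: H_def)
    then show ?case using step by (simp add: algebra_simps)
  qed
  have tel: "(\<Sum>x\<in>{u..<v}. w x - w (Suc x)) = w u - w v"
    using True by (induction v rule: dec_induct) auto
  have "\<bar>\<Sum>x\<in>{u..<v}. g x * w x\<bar>
      \<le> (\<Sum>x\<in>{u..<v}. \<bar>H (Suc x) * (w x - w (Suc x))\<bar>) + \<bar>H v * w v\<bar>"
    unfolding eq by (rule order_trans[OF abs_triangle_ineq]) (simp add: sum_abs)
  also have "\<dots> \<le> (\<Sum>x\<in>{u..<v}. B * (w x - w (Suc x))) + B * w v"
  proof (intro add_mono sum_mono)
    fix x assume "x \<in> {u..<v}"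
    then show "\<bar>H (Suc x) * (w x - w (Suc x))\<bar> \<le> B * (w x - w (Suc x))"
      using dec[of x] G[of "Suc x"] unfolding H_def abs_mult by (intro mult_mono) auto
  next
    show "\<bar>H v * w v\<bar> \<le> B * w v"
      using pos[OF True] G[of v] unfolding H_def abs_mult by (intro mult_mono) auto
  qed
  also have "\<dots> = B * w u"
    unfolding sum_distrib_left[symmetric] tel by (simp add: algebra_simps)
  finally show ?thesis .
qed

lemma sum_inverse_sqrt_le: "(\<Sum>d\<in>{1..n}. 1 / sqrt (real d)) \<le> 2 * sqrt (real n)"
proof (induction n)
  case (Suc n)
  have "1 \<le> 2 * sqrt (real (Suc n)) * (sqrt (real (Suc n)) - sqrt (real n))"
  proof -
    have "2 * (sqrt (real (Suc n)) * sqrt (real n)) \<le> sqrt (real (Suc n))^2 + sqrt (real n)^2"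
      using sum_squares_bound[of "sqrt (real (Suc n))" "sqrt (real n)"] by (simp add: ac_simps)
    then show ?thesis by (simp add: algebra_simps power2_eq_square)
  qed
  then have "1 \<le> 2 * (sqrt (real (Suc n)) - sqrt (real n)) * sqrt (real (Suc n))"
    by (simp add: algebra_simps)
  then have "1 / sqrt (real (Suc n)) \<le> 2 * (sqrt (real (Suc n)) - sqrt (real n))"
    by (subst pos_divide_le_eq) auto
  then show ?case using Suc by simp
qed simp

text \<open>
  Dirichlet's hyperbola method. The points under the hyperbola \<open>d e = Y\<^sup>2\<close> split into the square
  \<open>d, e \<le> Y\<close>, where the sum is a product of two bounded sums, and two wings. In a wing each inner sum is
  a tail that starts beyond \<open>Y\<close>, of size at most \<open>B / sqrt Y\<close>, and the outer weights add up to at most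
  \<open>2 sqrt Y\<close>. The weight \<open>1 / sqrt x\<close> balances the two, so that the bound does not depend on \<open>Y\<close>.
\<close>

lemma hyperbola_bound:
  fixes f g :: "nat \<Rightarrow> real"
  assumes f: "\<And>u v. \<bar>\<Sum>x\<in>{u..<v}. f x\<bar> \<le> B" "\<And>x. \<bar>f x\<bar> \<le> 1"
    and g: "\<And>u v. \<bar>\<Sum>x\<in>{u..<v}. g x\<bar> \<le> B" "\<And>x. \<bar>g x\<bar> \<le> 1"
  shows "\<bar>\<Sum>(d, e) | 0 < d \<and> 0 < e \<and> d * e \<le> Y^2. f d / sqrt (real d) * (g e / sqrt (real e))\<bar>
    \<le> B^2 + 4 * B"
proof (cases "Y = 0")
  case True
  have "0 \<le> B" using f(1)[of 0 0] by simp
  then have "0 \<le> B^2 + 4 * B" by simp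
  moreover have "{(d, e). 0 < d \<and> 0 < e \<and> d * e \<le> Y^2} = {}" using True by auto
  ultimately show ?thesis by (simp only: sum.empty abs_zero)
next
  case False
  then have Y: "Y > 0" by simp
  have B: "0 \<le> B" using f(1)[of 0 0] by simp
  define a where "a d = f d / sqrt (real d)" for d
  define b where "b d = g d / sqrt (real d)" for d
  have tail: "\<bar>\<Sum>x\<in>{u..<v}. h x / sqrt (real x)\<bar> \<le> B / sqrt (real u)"
    if "\<And>u v. \<bar>\<Sum>x\<in>{u..<v}. h x\<bar> \<le> B" "u > 0" for h :: "nat \<Rightarrow> real" and u v
  proof -
    have "1 / sqrt (real (Suc x)) \<le> 1 / sqrt (real x)" if "u \<le> x" for x
      using that \<open>u > 0\<close> by (intro divide_left_mono) (auto intro!: mult_pos_pos)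
    then show ?thesis
      using abel_summation_bound[where u = u and g = h and B = B and v = v and w = "\<lambda>x. 1 / sqrt (real x)"] that(1)
      by simp
  qed
  have head: "\<bar>\<Sum>x\<in>{1..Y}. h x / sqrt (real x)\<bar> \<le> B"
    if "\<And>u v. \<bar>\<Sum>x\<in>{u..<v}. h x\<bar> \<le> B" for h :: "nat \<Rightarrow> real"
    using tail[of h 1 "Suc Y"] that by (simp add: atLeastLessThanSuc_atLeastAtMost)
  have wing: "\<bar>\<Sum>d\<in>{1..Y}. h d / sqrt (real d) * (\<Sum>e\<in>{Suc Y..<Suc (Y^2 div d)}. k e / sqrt (real e))\<bar> \<le> 2 * B"
    if h: "\<And>x. \<bar>h x\<bar> \<le> 1" and k: "\<And>u v. \<bar>\<Sum>x\<in>{u..<v}. k x\<bar> \<le> B" for h k :: "nat \<Rightarrow> real"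
  proof -
    have "\<bar>\<Sum>d\<in>{1..Y}. h d / sqrt (real d) * (\<Sum>e\<in>{Suc Y..<Suc (Y^2 div d)}. k e / sqrt (real e))\<bar>
      \<le> (\<Sum>d\<in>{1..Y}. 1 / sqrt (real d) * (B / sqrt (real Y)))"
    proof (rule order_trans[OF sum_abs], rule sum_mono)
      fix d assume "d \<in> {1..Y}"
      have "\<bar>\<Sum>e\<in>{Suc Y..<Suc (Y^2 div d)}. k e / sqrt (real e)\<bar> \<le> B / sqrt (real (Suc Y))"
        by (rule tail[OF k]) simp
      also have "\<dots> \<le> B / sqrt (real Y)"
        using B Y by (intro divide_left_mono) (auto intro!: mult_pos_pos)
      finally show "\<bar>h d / sqrt (real d) * (\<Sum>e\<in>{Suc Y..<Suc (Y^2 div d)}. k e / sqrt (real e))\<bar>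
          \<le> 1 / sqrt (real d) * (B / sqrt (real Y))"
        unfolding abs_mult using h[of d] by (intro mult_mono) (auto intro: divide_right_mono)
    qed
    also have "\<dots> = (\<Sum>d\<in>{1..Y}. 1 / sqrt (real d)) * (B / sqrt (real Y))"
      by (rule sum_distrib_right[symmetric])
    also have "\<dots> \<le> 2 * sqrt (real Y) * (B / sqrt (real Y))"
      using B by (intro mult_right_mono sum_inverse_sqrt_le) auto
    also have "\<dots> = 2 * B" using Y by simp
    finally show ?thesis .
  qed
  define S1 where "S1 = {1..Y} \<times> {1..Y}"
  define S2 where "S2 = (SIGMA d:{1..Y}. {Suc Y..<Suc (Y^2 div d)})"
  define S3 where "S3 = prod.swap ` S2"
  define F where "F = (\<lambda>(d, e). a d * b e)"
  have fin: "finite S1" "finite S2" "finite S3" unfolding S1_def S2_def S3_def by auto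
  have div: "e \<le> Y^2 div d \<longleftrightarrow> d * e \<le> Y^2" if "d > 0" for d e
    using that by (simp add: less_eq_div_iff_mult_less_eq mult.commute)
  have part: "{(d, e). 0 < d \<and> 0 < e \<and> d * e \<le> Y^2} = S1 \<union> S2 \<union> S3"
  proof -
    have le: "d * e \<le> Y^2" if "d \<le> Y" "e \<le> Y" for d e
      using that by (simp add: power2_eq_square mult_le_mono)
    have gt: "\<not> (Y < d \<and> Y < e)" if "d * e \<le> Y^2" for d e
      using that mult_strict_mono[of Y d Y e] by (auto simp: power2_eq_square)
    show ?thesis
    proof (rule Set.set_eqI)
      fix z :: "nat \<times> nat"
      obtain d e where z: "z = (d, e)" by (cases z)
      show "z \<in> {(d, e). 0 < d \<and> 0 < e \<and> d * e \<le> Y^2} \<longleftrightarrow> z \<in> S1 \<union> S2 \<union> S3"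
        using le[of d e] gt[of d e] div[of d e] div[of e d]
        unfolding S1_def S2_def S3_def z
        by (auto simp: image_iff less_Suc_eq_le mult.commute)
    qed
  qed
  moreover have "sum F (S1 \<union> S2 \<union> S3) = sum F S1 + sum F S2 + sum F S3"
  proof -
    have "S1 \<inter> S2 = {}" "(S1 \<union> S2) \<inter> S3 = {}"
      unfolding S1_def S2_def S3_def by auto
    then show ?thesis using fin by (simp add: sum.union_disjoint)
  qed
  moreover have "\<bar>sum F S1\<bar> \<le> B^2"
  proof -
    have "sum F S1 = (\<Sum>d\<in>{1..Y}. a d) * (\<Sum>e\<in>{1..Y}. b e)"
      unfolding S1_def F_def by (simp add: sum_product sum.cartesian_product)
    then show ?thesis
      using head[OF f(1)] head[OF g(1)] B unfolding a_def b_def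
      by (auto simp: abs_mult power2_eq_square intro!: mult_mono)
  qed
  moreover have "\<bar>sum F S2\<bar> \<le> 2 * B"
  proof -
    have "sum F S2 = (\<Sum>d\<in>{1..Y}. \<Sum>e\<in>{Suc Y..<Suc (Y^2 div d)}. a d * b e)"
      unfolding S2_def F_def by (subst sum.Sigma) auto
    also have "\<dots> = (\<Sum>d\<in>{1..Y}. a d * (\<Sum>e\<in>{Suc Y..<Suc (Y^2 div d)}. b e))"
      by (simp only: sum_distrib_left)
    finally show ?thesis
      using wing[where h = f and k = g, OF f(2) g(1)] unfolding a_def b_def by simp
  qed
  moreover have "\<bar>sum F S3\<bar> \<le> 2 * B"
  proof -
    have "sum F S3 = (\<Sum>(e, d)\<in>S2. a d * b e)"
      unfolding S3_def F_def by (subst sum.reindex) (auto intro!: sum.cong)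
    also have "\<dots> = (\<Sum>e\<in>{1..Y}. \<Sum>d\<in>{Suc Y..<Suc (Y^2 div e)}. a d * b e)"
      unfolding S2_def by (subst sum.Sigma) auto
    also have "\<dots> = (\<Sum>e\<in>{1..Y}. b e * (\<Sum>d\<in>{Suc Y..<Suc (Y^2 div e)}. a d))"
      by (simp only: sum_distrib_left mult.commute)
    finally show ?thesis
      using wing[where h = g and k = f, OF g(2) f(1)] unfolding a_def b_def by simp
  qed
  ultimately have "\<bar>sum F (S1 \<union> S2 \<union> S3)\<bar> \<le> B^2 + 4 * B" by linarith
  then show ?thesis unfolding part F_def a_def b_def .
qed

section \<open>Divisor sums of a real character\<close>

lemma gcd_mult_coprime_nat:
  fixes d u v :: nat
  assumes "coprime u v" "d dvd u * v"
  shows "gcd d u * gcd d v = d"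
proof (rule dvd_antisym)
  have "coprime (gcd d u) (gcd d v)"
    using assms(1) by (meson coprime_divisors gcd_dvd2)
  then show "gcd d u * gcd d v dvd d" by (intro divides_mult) auto
  have "v * gcd d u = gcd (v * d) (v * u)" by (rule gcd_mult_distrib_nat)
  then have "d dvd gcd d u * v" using assms(2) by (simp add: mult.commute)
  moreover have "gcd d u * gcd d v = gcd (gcd d u * d) (gcd d u * v)" by (rule gcd_mult_distrib_nat)
  ultimately show "d dvd gcd d u * gcd d v" by (metis dvd_triv_right gcd_greatest)
qed

text \<open>
  The Dirichlet convolution of \<open>f\<close> with the constant function 1.
\<close>

definition divisor_sum :: "(nat \<Rightarrow> int) \<Rightarrow> nat \<Rightarrow> int" where
  "divisor_sum f n = (\<Sum>d | d dvd n. f d)"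

lemma divisor_sum_coprime_mult:
  assumes f: "\<And>x y. f (x * y) = f x * f y" and cop: "coprime u v"
  shows "divisor_sum f (u * v) = divisor_sum f u * divisor_sum f v"
proof -
  have gl: "gcd (a * b) u = a" "gcd (a * b) v = b" if "a dvd u" "b dvd v" for a b
  proof -
    have "coprime u b" "coprime a v" using that cop
      by (meson coprime_divisors dvd_refl)+
    then show "gcd (a * b) u = a" "gcd (a * b) v = b"
      using that by (simp_all add: gcd_mult_left_right_cancel gcd_mult_left_left_cancel coprime_commute gcd_proj1_iff)
  qed
  have "divisor_sum f u * divisor_sum f v = (\<Sum>(a, b)\<in>{d. d dvd u} \<times> {d. d dvd v}. f a * f b)"
    unfolding divisor_sum_def by (simp add: sum_product sum.cartesian_product)
  also have "\<dots> = (\<Sum>d | d dvd u * v. f d)"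
    by (rule sum.reindex_bij_witness[where i = "\<lambda>d. (gcd d u, gcd d v)" and j = "\<lambda>(a, b). a * b"])
      (auto simp: gl f gcd_mult_coprime_nat[OF cop] mult_dvd_mono)
  finally show ?thesis by (simp add: divisor_sum_def)
qed

lemma divisor_sum_prime_power:
  assumes f: "real_char m f" and p: "prime p"
  shows "divisor_sum f (p ^ e) = (\<Sum>i\<le>e. f p ^ i)"
proof -
  have "{d. d dvd p ^ e} = (\<lambda>i. p ^ i) ` {..e}"
    using p by (auto simp: divides_primepow_nat)
  moreover have "inj_on (\<lambda>i. p ^ i) {..e}"
    using prime_gt_1_nat[OF p] by (auto simp: inj_on_def)
  ultimately show ?thesis
    unfolding divisor_sum_def by (simp add: sum.reindex real_char_power[OF f])
qed

lemma sum_powers_sign: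
  fixes c :: int
  assumes "c \<in> {-1, 0, 1}"
  shows "0 \<le> (\<Sum>i\<le>e. c ^ i)" "even e \<Longrightarrow> 1 \<le> (\<Sum>i\<le>e. c ^ i)"
    "odd e \<Longrightarrow> c = -1 \<Longrightarrow> (\<Sum>i\<le>e. c ^ i) = 0"
proof -
  have m1: "(\<Sum>i\<le>e. (-1) ^ i) = (if even e then 1 else 0 :: int)"
    by (induction e) auto
  have z: "(\<Sum>i\<le>e. 0 ^ i) = (1 :: int)" by (induction e) auto
  have "(\<Sum>i\<le>e. c ^ i) = (if c = -1 then if even e then 1 else 0 else if c = 0 then 1 else int e + 1)"
    using assms m1 z by auto
  then show "0 \<le> (\<Sum>i\<le>e. c ^ i)" "even e \<Longrightarrow> 1 \<le> (\<Sum>i\<le>e. c ^ i)"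
    "odd e \<Longrightarrow> c = -1 \<Longrightarrow> (\<Sum>i\<le>e. c ^ i) = 0" by auto
qed

text \<open>
  By multiplicativity this is a statement about prime powers: \<open>\<Sum>i\<le>e. f p ^ i\<close> is at least 0, and at
  least 1 when \<open>e\<close> is even.
\<close>

lemma divisor_sum_nonneg:
  assumes f: "real_char m f" and "n > 0"
  shows "0 \<le> divisor_sum f n \<and> ((\<exists>k. n = k^2) \<longrightarrow> 1 \<le> divisor_sum f n)"
  using \<open>n > 0\<close>
proof (induction n rule: less_induct)
  case (less n)
  show ?case
  proof (cases "n = 1")
    case True
    then show ?thesis using real_char_1[OF f] by (simp add: divisor_sum_def)
  next
    case False
    then obtain p where p: "prime p" "p dvd n" using prime_factor_nat by blast
    define e where "e = multiplicity p n"
    obtain n' where n': "n = p ^ e * n'" "\<not> p dvd n'"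
      using multiplicity_decompose'[of n p] p less.prems unfolding e_def
      by (metis not_prime_unit not_gr_zero)
    have cop: "coprime (p ^ e) n'"
      using n' p by (simp add: prime_imp_coprime)
    have "e > 0" using p less.prems unfolding e_def
      by (simp add: prime_multiplicity_gt_zero_iff)
    then have "p ^ e > 1" using prime_gt_1_nat[OF p(1)] by (intro one_less_power) auto
    moreover have "n' > 0" using n' less.prems by (cases n') auto
    ultimately have "n' < n" using n' by simp
    note IH = less.IH[OF this \<open>n' > 0\<close>]
    have eq: "divisor_sum f n = (\<Sum>i\<le>e. f p ^ i) * divisor_sum f n'"
      using divisor_sum_coprime_mult[OF real_charD(2)[OF f] cop] divisor_sum_prime_power[OF f p(1)] n' by simp
    have nn: "0 \<le> divisor_sum f n"
      using eq IH sum_powers_sign(1)[OF real_charD(4)[OF f]] by simp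
    have "1 \<le> divisor_sum f n" if k: "n = k^2" for k
    proof -
      have k0: "k > 0" using k less.prems by (cases k) auto
      have ee: "e = 2 * multiplicity p k"
        using k k0 p unfolding e_def by (simp add: prime_elem_multiplicity_power_distrib)
      obtain k' where k': "k = p ^ multiplicity p k * k'"
        using multiplicity_dvd[of p k] by (elim dvdE)
      have "p ^ e * n' = p ^ e * k'^2"
      proof -
        have "p ^ e * n' = (p ^ multiplicity p k * k')^2" using k n' k' by simp
        also have "\<dots> = p ^ e * k'^2" unfolding ee by (simp add: power_mult_distrib power_mult mult.commute)
        finally show ?thesis .
      qed
      then have "n' = k'^2" using p by auto
      then have "1 \<le> divisor_sum f n'" using IH by blast
      moreover have "1 \<le> (\<Sum>i\<le>e. f p ^ i)"
        using sum_powers_sign(2)[OF real_charD(4)[OF f, of p], of e] ee by simp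
      ultimately show ?thesis unfolding eq by (metis mult_mono' mult_1 zero_le_one)
    qed
    then show ?thesis using nn by blast
  qed
qed

text \<open>
  Otherwise the factor \<open>\<Sum>i\<le>e. (-1) ^ i\<close> of the divisor sum, with \<open>e\<close> odd, would vanish. This turns the
  positivity of a divisor sum into conditions on prime factors.
\<close>

lemma divisor_sum_pos_odd_multiplicity:
  assumes f: "real_char m f" and n: "divisor_sum f n > 0" "n > 0" "coprime n m"
    and p: "prime p" "odd (multiplicity p n)"
  shows "f p = 1"
proof (rule ccontr)
  assume "f p \<noteq> 1"
  have "p dvd n" using p by (metis even_zero not_dvd_imp_multiplicity_0)
  then have "coprime p m" using n(3) by (meson coprime_divisors dvd_refl)
  then have fp: "f p = -1" using real_char_unit[OF f] \<open>f p \<noteq> 1\<close> by blast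
  obtain n' where n': "n = p ^ multiplicity p n * n'" "\<not> p dvd n'"
    using multiplicity_decompose'[of n p] p n
    by (metis not_prime_unit not_gr_zero)
  have cop: "coprime (p ^ multiplicity p n) n'"
    using n' p by (simp add: prime_imp_coprime)
  have "divisor_sum f n = (\<Sum>i\<le>multiplicity p n. f p ^ i) * divisor_sum f n'"
    using divisor_sum_coprime_mult[OF real_charD(2)[OF f] cop] divisor_sum_prime_power[OF f p(1)] n'(1) by simp
  also have "\<dots> = 0" using sum_powers_sign(3)[OF real_charD(4)[OF f, of p] p(2) fp] by simp
  finally show False using n by simp
qed

text \<open>
  If \<open>f n = -1\<close>, the complementary divisors \<open>d\<close> and \<open>n div d\<close> contribute opposite values.
\<close>

lemma divisor_sum_pos_imp_char_1:
  assumes f: "real_char m f" and n: "divisor_sum f n > 0" "n > 0" "coprime n m"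
  shows "f n = 1"
proof (rule ccontr)
  assume "f n \<noteq> 1"
  then have fn: "f n = -1" using real_char_unit[OF f n(3)] by blast
  have "f d = - f (n div d)" if "d dvd n" for d
  proof -
    have "f d * f (n div d) = -1"
      using that fn real_charD(2)[OF f, of d "n div d"] by simp
    then show ?thesis using real_charD(4)[OF f, of d] real_charD(4)[OF f, of "n div d"] by auto
  qed
  then have "divisor_sum f n = (\<Sum>d | d dvd n. - f (n div d))"
    unfolding divisor_sum_def by (intro sum.cong) auto
  also have "\<dots> = - (\<Sum>d | d dvd n. f (n div d))" by (rule sum_negf)
  also have "(\<Sum>d | d dvd n. f (n div d)) = divisor_sum f n"
    unfolding divisor_sum_def
    by (rule sum.reindex_bij_witness[where i = "\<lambda>d. n div d" and j = "\<lambda>d. n div d"]) (use n in auto)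
  finally show False using n by simp
qed

lemma ln_le_harmonic: "ln (real n + 1) \<le> (\<Sum>s<n. 1 / (real s + 1))"
proof (induction n)
  case (Suc n)
  have pos: "1 + 1 / (real n + 1) > 0" by (simp add: add_pos_pos)
  have "real (Suc n) + 1 = (real n + 1) * (1 + 1 / (real n + 1))"
    by (simp add: field_simps)
  then have "ln (real (Suc n) + 1) = ln (real n + 1) + ln (1 + 1 / (real n + 1))"
    using pos by (simp add: ln_mult_pos)
  moreover have "ln (1 + 1 / (real n + 1)) \<le> 1 / (real n + 1)" by (rule ln_add_one_self_le_self) simp
  ultimately show ?case using Suc by simp
qed simp

text \<open>
  Twisting by \<open>g\<close> turns the convolution of 1 and \<open>f\<close> into the convolution of \<open>g\<close> and \<open>f g\<close>; this is the
  form that the hyperbola method applies to.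
\<close>

lemma sum_twisted_divisor_sum:
  assumes f: "real_char m f" and g: "real_char m g"
  shows "(\<Sum>q\<in>{1..X}. of_int (g q * divisor_sum f q) / sqrt (real q)) =
    (\<Sum>(d, e) | 0 < d \<and> 0 < e \<and> d * e \<le> X. of_int (f d * g d) / sqrt (real d) * (of_int (g e) / sqrt (real e)))"
proof -
  have "(\<Sum>q\<in>{1..X}. of_int (g q * divisor_sum f q) / sqrt (real q))
      = (\<Sum>q\<in>{1..X}. \<Sum>d | d dvd q. of_int (f d * g q) / sqrt (real q))"
    unfolding divisor_sum_def
    by (simp add: sum_distrib_left sum_divide_distrib mult.commute)
  also have "\<dots> = (\<Sum>(q, d)\<in>(SIGMA q:{1..X}. {d. d dvd q}). of_int (f d * g q) / sqrt (real q))"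
    by (subst sum.Sigma) auto
  also have "\<dots> = (\<Sum>(d, e) | 0 < d \<and> 0 < e \<and> d * e \<le> X. of_int (f d * g d) / sqrt (real d) * (of_int (g e) / sqrt (real e)))"
    by (rule sum.reindex_bij_witness[where i = "\<lambda>(d, e). (d * e, d)" and j = "\<lambda>(q, d). (d, q div d)"])
      (auto simp: real_charD(2)[OF g] real_sqrt_mult elim!: dvdE)
  finally show ?thesis .
qed

section \<open>Integers with prescribed character values\<close>

text \<open>
  The terms are nonnegative, and at a square \<open>t\<^sup>2\<close> with \<open>t\<close> coprime to \<open>m\<close> the term is at least \<open>1 / t\<close>.
  Already the numbers \<open>t = m s + 1\<close> produce a multiple of the harmonic series.
\<close>

lemma sum_divisor_sum_unbounded:
  assumes f: "real_char m f"
  shows "\<exists>Y. (\<Sum>q\<in>{1..Y^2}. of_int (of_bool (coprime q m) * divisor_sum f q) / sqrt (real q)) > C"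
proof -
  have m: "m > 0" by (rule real_charD(1)[OF f])
  obtain S :: nat where S: "exp (m * \<bar>C\<bar> + m) < real S" using reals_Archimedean2 by blast
  define Y where "Y = m * S + 1"
  define G where "G q = of_int (of_bool (coprime q m) * divisor_sum f q) / sqrt (real q)" for q
  have nn: "G q \<ge> 0" if "q > 0" for q
    using divisor_sum_nonneg[OF f that] unfolding G_def by simp
  define t where "t s = (m * s + 1)^2" for s
  have inj: "inj_on t {..<S}" using m unfolding t_def by (auto simp: inj_on_def power2_eq_iff)
  have sub: "t ` {..<S} \<subseteq> {1..Y^2}"
  proof (rule image_subsetI)
    fix s assume "s \<in> {..<S}"
    then have "m * s + 1 \<le> Y" unfolding Y_def by simp
    then show "t s \<in> {1..Y^2}" unfolding t_def using power_mono[of "m * s + 1" Y 2] by simp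
  qed
  have Gt: "1 / (m * (real s + 1)) \<le> G (t s)" for s
  proof -
    have "coprime (m * s + 1) m"
      by (metis coprime_1_left coprime_iff_gcd_eq_1 gcd_add_mult gcd.commute mult.commute)
    then have cop: "coprime (t s) m" unfolding t_def by simp
    have "t s > 0" "\<exists>k. t s = k^2" unfolding t_def by auto
    then have "1 \<le> divisor_sum f (t s)" using divisor_sum_nonneg[OF f, of "t s"] by blast
    then have "1 \<le> real_of_int (divisor_sum f (t s))" by linarith
    moreover have "sqrt (real (t s)) = m * s + 1" unfolding t_def by (simp add: real_sqrt_power)
    ultimately have "1 / (m * s + 1) \<le> G (t s)" unfolding G_def using cop
      by (simp add: divide_right_mono)
    moreover have "1 / (m * (real s + 1)) \<le> 1 / (m * s + 1)"
      using m by (intro divide_left_mono) (auto simp: algebra_simps intro!: mult_pos_pos add_pos_nonneg)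
    ultimately show ?thesis by simp
  qed
  have "C < (1 / m) * ln (real S + 1)"
  proof -
    have "m * \<bar>C\<bar> + m < ln (real S + 1)"
    proof -
      have "exp (m * \<bar>C\<bar> + m) < real S + 1" using S by simp
      then have "ln (exp (m * \<bar>C\<bar> + m)) < ln (real S + 1)"
        by (subst ln_less_cancel_iff) auto
      then show ?thesis by simp
    qed
    moreover have "m * C \<le> m * \<bar>C\<bar>" by (intro mult_left_mono) auto
    ultimately have "m * C < ln (real S + 1)" using m by linarith
    then show ?thesis using m by (simp add: field_simps)
  qed
  also have "\<dots> \<le> (1 / m) * (\<Sum>s<S. 1 / (real s + 1))"
    using ln_le_harmonic[of S] by (intro mult_left_mono) auto
  also have "\<dots> = (\<Sum>s<S. 1 / (m * (real s + 1)))" by (simp add: sum_distrib_left)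
  also have "\<dots> \<le> (\<Sum>s<S. G (t s))" by (intro sum_mono Gt)
  also have "\<dots> = sum G (t ` {..<S})" by (simp add: sum.reindex[OF inj])
  also have "\<dots> \<le> sum G {1..Y^2}" by (intro sum_mono2 sub nn) auto
  finally show ?thesis unfolding G_def by blast
qed

lemma real_char_sum_interval_real:
  assumes "real_char m f" "f a = -1"
  shows "\<bar>\<Sum>x\<in>{u..<v}. real_of_int (f x)\<bar> \<le> real m"
proof -
  have "\<bar>\<Sum>x\<in>{u..<v}. real_of_int (f x)\<bar> = real_of_int \<bar>\<Sum>x\<in>{u..<v}. f x\<bar>" by simp
  also have "\<dots> \<le> real_of_int (int m)"
    using real_char_sum_interval[OF assms] by (simp only: of_int_le_iff)
  finally show ?thesis by simp
qed

text \<open>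
  This takes the place of Dirichlet's theorem on primes in arithmetic progressions. The factor
  \<open>\<Prod>j\<in>J. 1 + \<epsilon> j * \<psi> j q\<close> detects the prescribed values. Expanding it over the subsets \<open>A\<close> of \<open>J\<close> splits the
  sum of \<open>divisor_sum \<chi> q / sqrt q\<close> over the good \<open>q\<close> into twists by the products \<open>\<Psi> A\<close>. For nonempty \<open>A\<close>
  both \<open>\<Psi> A\<close> and \<open>\<chi> \<Psi> A\<close> take the value \<open>-1\<close>, by the two independence hypotheses, so the hyperbola method
  bounds that twist; the empty subset contributes an unbounded sum. So a good \<open>q\<close> exists. The value
  \<open>\<chi> q\<close> cannot be prescribed on top of this: positivity of the divisor sum forces it to be 1.
\<close>

theorem exists_prescribed_characters:
  assumes J: "finite J" and \<psi>: "\<And>j. j \<in> J \<Longrightarrow> real_char m (\<psi> j)" and \<chi>: "real_char m \<chi>"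
    and indep: "\<And>j. j \<in> J \<Longrightarrow> \<exists>a. \<psi> j a = -1 \<and> (\<forall>i\<in>J - {j}. \<psi> i a = 1)"
    and indep': "\<exists>c. \<chi> c = -1 \<and> (\<forall>i\<in>J. \<psi> i c = 1)"
    and \<epsilon>: "\<And>j. j \<in> J \<Longrightarrow> \<epsilon> j = 1 \<or> \<epsilon> j = -1"
  shows "\<exists>q>0. coprime q m \<and> divisor_sum \<chi> q > 0 \<and> (\<forall>j\<in>J. \<psi> j q = \<epsilon> j)"
proof (rule ccontr)
  assume contra: "\<not> ?thesis"
  have m: "m > 0" by (rule real_charD(1)[OF \<chi>])
  define \<Psi> where "\<Psi> A x = of_bool (coprime x m) * (\<Prod>j\<in>A. \<psi> j x)" for A x
  have finA: "finite A" if "A \<subseteq> J" for A using that J finite_subset by blast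
  have \<Psi>: "real_char m (\<Psi> A)" if "A \<subseteq> J" for A
    unfolding \<Psi>_def using that \<psi> by (intro real_char_prod finA m) auto
  define S where "S A Y = (\<Sum>q\<in>{1..Y^2}. of_int (\<Psi> A q * divisor_sum \<chi> q) / sqrt (real q))" for A and Y :: nat
  define C where "C = (real m)^2 + 4 * real m"
  have bound: "\<bar>S A Y\<bar> \<le> C" if A: "A \<subseteq> J" "A \<noteq> {}" for A Y
  proof -
    obtain j where j: "j \<in> A" using A by blast
    obtain a where a: "\<psi> j a = -1" "\<forall>i\<in>J - {j}. \<psi> i a = 1" using indep[of j] j A by blast
    have "coprime a m" using real_charD(5)[OF \<psi>, of j a] j A a by auto
    moreover have "(\<Prod>i\<in>A. \<psi> i a) = \<psi> j a * (\<Prod>i\<in>A - {j}. \<psi> i a)"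
      by (rule prod.remove[OF finA[OF A(1)] j])
    moreover have "(\<Prod>i\<in>A - {j}. \<psi> i a) = 1" using a(2) A by (intro prod.neutral) auto
    ultimately have \<Psi>a: "\<Psi> A a = -1" unfolding \<Psi>_def using a by simp
    obtain c where c: "\<chi> c = -1" "\<forall>i\<in>J. \<psi> i c = 1" using indep' by blast
    have "coprime c m" using real_charD(5)[OF \<chi>, of c] c by auto
    moreover have "(\<Prod>i\<in>A. \<psi> i c) = 1" using c(2) A by (intro prod.neutral) auto
    ultimately have \<chi>c: "\<chi> c * \<Psi> A c = -1" unfolding \<Psi>_def using c by simp
    have \<chi>\<Psi>: "real_char m (\<lambda>x. \<chi> x * \<Psi> A x)" by (rule real_char_mult[OF \<chi> \<Psi>[OF A(1)]])
    have le1: "\<bar>real_of_int (h x)\<bar> \<le> 1" if "real_char m h" for h x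
      using real_charD(4)[OF that, of x] by auto
    have "\<bar>\<Sum>(d, e) | 0 < d \<and> 0 < e \<and> d * e \<le> Y^2.
        real_of_int (\<chi> d * \<Psi> A d) / sqrt (real d) * (real_of_int (\<Psi> A e) / sqrt (real e))\<bar> \<le> C"
      unfolding C_def
    proof (rule hyperbola_bound)
      show "\<bar>\<Sum>x\<in>{u..<v}. real_of_int (\<chi> x * \<Psi> A x)\<bar> \<le> real m" for u v
        by (rule real_char_sum_interval_real[OF \<chi>\<Psi> \<chi>c])
      show "\<bar>real_of_int (\<chi> x * \<Psi> A x)\<bar> \<le> 1" for x by (rule le1[OF \<chi>\<Psi>])
      show "\<bar>\<Sum>x\<in>{u..<v}. real_of_int (\<Psi> A x)\<bar> \<le> real m" for u v
        by (rule real_char_sum_interval_real[OF \<Psi>[OF A(1)] \<Psi>a])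
      show "\<bar>real_of_int (\<Psi> A x)\<bar> \<le> 1" for x by (rule le1[OF \<Psi>[OF A(1)]])
    qed
    then show ?thesis unfolding S_def sum_twisted_divisor_sum[OF \<chi> \<Psi>[OF A(1)]] .
  qed
  define eA where "eA A = (\<Prod>j\<in>A. \<epsilon> j)" for A
  have eA: "\<bar>eA A\<bar> = 1" if "A \<subseteq> J" for A
    unfolding eA_def abs_prod using that \<epsilon> by (intro prod.neutral) fastforce
  have zero: "(\<Sum>A\<in>Pow J. of_int (eA A) * S A Y) = 0" for Y
  proof -
    \<comment> \<open>no \<open>q\<close> is good, so each term vanishes: the divisor sum is 0 or some sign is wrong\<close>
    have van: "of_bool (coprime q m) * (\<Prod>j\<in>J. 1 + \<epsilon> j * \<psi> j q) * divisor_sum \<chi> q = 0" if "q > 0" for q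
    proof (cases "coprime q m \<and> divisor_sum \<chi> q \<noteq> 0")
      case True
      then have "divisor_sum \<chi> q > 0" using divisor_sum_nonneg[OF \<chi> that] by simp
      then have "\<not> (\<forall>j\<in>J. \<psi> j q = \<epsilon> j)"
        using contra that True by metis
      then obtain j where j: "j \<in> J" "\<psi> j q \<noteq> \<epsilon> j" by blast
      then have "1 + \<epsilon> j * \<psi> j q = 0"
        using real_char_unit[OF \<psi>[OF j(1)], of q] True \<epsilon>[OF j(1)] by auto
      then have "(\<Prod>j\<in>J. 1 + \<epsilon> j * \<psi> j q) = 0" using J j by (meson prod_zero)
      then show ?thesis by simp
    qed auto
    have expand: "of_bool (coprime q m) * (\<Prod>j\<in>J. 1 + \<epsilon> j * \<psi> j q) = (\<Sum>A\<in>Pow J. eA A * \<Psi> A q)" for q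
    proof -
      have "(\<Prod>j\<in>J. \<epsilon> j * \<psi> j q + 1) = (\<Sum>A\<in>Pow J. (\<Prod>j\<in>A. \<epsilon> j * \<psi> j q) * (\<Prod>j\<in>J - A. 1))"
        by (rule prod_add[OF J])
      also have "\<dots> = (\<Sum>A\<in>Pow J. eA A * (\<Prod>j\<in>A. \<psi> j q))"
        unfolding eA_def by (simp add: prod.distrib)
      finally show ?thesis unfolding \<Psi>_def
        by (simp add: sum_distrib_left add.commute mult.left_commute)
    qed
    have "(\<Sum>A\<in>Pow J. of_int (eA A) * S A Y)
        = (\<Sum>A\<in>Pow J. \<Sum>q\<in>{1..Y^2}. of_int (eA A * \<Psi> A q * divisor_sum \<chi> q) / sqrt (real q))"
      unfolding S_def by (simp add: sum_distrib_left mult.assoc)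
    also have "\<dots> = (\<Sum>q\<in>{1..Y^2}. \<Sum>A\<in>Pow J. of_int (eA A * \<Psi> A q * divisor_sum \<chi> q) / sqrt (real q))"
      by (rule sum.swap)
    also have "\<dots> = (\<Sum>q\<in>{1..Y^2}. of_int ((\<Sum>A\<in>Pow J. eA A * \<Psi> A q) * divisor_sum \<chi> q) / sqrt (real q))"
      by (simp only: sum_distrib_right of_int_sum sum_divide_distrib)
    also have "\<dots> = 0"
      unfolding expand[symmetric]
    proof (intro sum.neutral ballI)
      fix q assume "q \<in> {1..Y^2}"
      then have "q > 0" by simp
      show "of_int (of_bool (coprime q m) * (\<Prod>j\<in>J. 1 + \<epsilon> j * \<psi> j q) * divisor_sum \<chi> q) / sqrt (real q) = 0"
        unfolding van[OF \<open>q > 0\<close>] by simp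
    qed
    finally show ?thesis .
  qed
  obtain Y :: nat where Y: "S {} Y > (\<Sum>A\<in>Pow J - {{}}. C)"
    using sum_divisor_sum_unbounded[OF \<chi>, of "\<Sum>A\<in>Pow J - {{}}. C"] unfolding S_def \<Psi>_def by auto
  have "0 = eA {} * S {} Y + (\<Sum>A\<in>Pow J - {{}}. of_int (eA A) * S A Y)"
    using zero[of Y] J by (subst (asm) sum.remove[of _ "{}"]) auto
  moreover have "\<bar>\<Sum>A\<in>Pow J - {{}}. of_int (eA A) * S A Y\<bar> \<le> (\<Sum>A\<in>Pow J - {{}}. C)"
  proof (rule order_trans[OF sum_abs], rule sum_mono)
    fix A assume "A \<in> Pow J - {{}}"
    then have "\<bar>real_of_int (eA A)\<bar> = 1" "\<bar>S A Y\<bar> \<le> C"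
      using eA[of A] bound[of A Y] by (auto simp flip: of_int_abs)
    then show "\<bar>of_int (eA A) * S A Y\<bar> \<le> C" by (simp add: abs_mult)
  qed
  moreover have "eA {} = 1" unfolding eA_def by simp
  ultimately show False using Y by simp
qed

section \<open>Legendre symbols as real characters\<close>

lemma Legendre_range: "Legendre a p \<in> {-1, 0, 1}"
  by (simp add: Legendre_def)

lemma Legendre_eq_0_iff: "Legendre a p = 0 \<longleftrightarrow> p dvd a"
  by (auto simp: Legendre_def cong_0_iff)

lemma Legendre_cong: "[a = b] (mod p) \<Longrightarrow> Legendre a p = Legendre b p"
proof -
  assume "[a = b] (mod p)"
  then have "[a = c] (mod p) \<longleftrightarrow> [b = c] (mod p)" "[c = a] (mod p) \<longleftrightarrow> [c = b] (mod p)" for c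
    by (metis cong_sym cong_trans)+
  then show ?thesis unfolding Legendre_def QuadRes_def by simp
qed

text \<open>
  Euler's criterion only gives congruences modulo \<open>p\<close>; between signs they are equalities.
\<close>

lemma sign_cong_imp_eq:
  fixes a b p :: int
  assumes "[a = b] (mod p)" "a \<in> {-1, 0, 1}" "b \<in> {-1, 0, 1}" "p > 2"
  shows "a = b"
proof -
  have "p dvd a - b" using assms(1) by (simp add: cong_iff_dvd_diff)
  moreover have "\<bar>a - b\<bar> < p" using assms by auto
  ultimately show ?thesis using dvd_imp_le_int[of "a - b" p] by fastforce
qed

lemma Legendre_mult:
  assumes "prime p" "p > (2 :: nat)"
  shows "Legendre (a * b) (int p) = Legendre a (int p) * Legendre b (int p)"
proof (rule sign_cong_imp_eq[where p = "int p"])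
  have "[Legendre (a * b) (int p) = (a * b) ^ ((p - 1) div 2)] (mod int p)"
    by (rule euler_criterion) (use assms in auto)
  moreover have "[Legendre a (int p) * Legendre b (int p) = a ^ ((p - 1) div 2) * b ^ ((p - 1) div 2)] (mod int p)"
    by (intro cong_mult euler_criterion) (use assms in auto)
  ultimately show "[Legendre (a * b) (int p) = Legendre a (int p) * Legendre b (int p)] (mod int p)"
    unfolding power_mult_distrib by (meson cong_sym cong_trans)
  show "Legendre a (int p) * Legendre b (int p) \<in> {-1, 0, 1}"
    using Legendre_range[of a p] Legendre_range[of b p] by auto
qed (use assms Legendre_range in auto)

lemma real_char_Legendre:
  assumes "prime p" "p > 2"
  shows "real_char p (\<lambda>x. Legendre (int x) (int p))"
  unfolding real_char_def
proof (intro conjI allI)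
  show "p > 0" using assms by simp
  show "Legendre (int (x * y)) (int p) = Legendre (int x) (int p) * Legendre (int y) (int p)" for x y
    using Legendre_mult[OF assms] by simp
  show "Legendre (int (x + p)) (int p) = Legendre (int x) (int p)" for x
    by (rule Legendre_cong) (simp add: cong_def)
  show "Legendre (int x) (int p) \<in> {-1, 0, 1}" for x by (rule Legendre_range)
  show "Legendre (int x) (int p) \<noteq> 0 \<longleftrightarrow> coprime x p" for x
    using assms by (auto simp: Legendre_eq_0_iff prime_imp_coprime coprime_commute coprime_absorb_right dest: not_prime_unit)
qed

lemma real_char_restrict:
  assumes f: "real_char k f" and "k dvd m" "m > 0"
  shows "real_char m (\<lambda>x. of_bool (coprime x m) * f x)"
  unfolding real_char_def
proof (intro conjI allI)
  have p: "real_char m (\<lambda>x. of_bool (coprime x m) :: int)" by (rule real_char_principal[OF assms(3)])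
  fix x y
  show "of_bool (coprime (x * y) m) * f (x * y) = of_bool (coprime x m) * f x * (of_bool (coprime y m) * f y)"
    using real_charD(2)[OF p] real_charD(2)[OF f] by simp
  have "[x + m = x] (mod k)" using assms(2) by (simp add: cong_def mod_add_self2 flip: mod_add_right_eq)
  then show "of_bool (coprime (x + m) m) * f (x + m) = of_bool (coprime x m) * f x"
    using real_charD(3)[OF p, of x] real_char_cong[OF f] by simp
  show "of_bool (coprime x m) * f x \<in> {-1, 0, 1}" using real_charD(4)[OF f, of x] by auto
  show "of_bool (coprime x m) * f x \<noteq> 0 \<longleftrightarrow> coprime x m"
    using real_charD(5)[OF f, of x] assms(2) coprime_divisors[of x x k m] by auto
qed (use assms in auto)

text \<open>
  If every residue were a square, squaring would be a surjective, hence injective, map on the residues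
  modulo \<open>p\<close>, but it identifies 1 and \<open>p - 1\<close>.
\<close>

lemma exists_nonresidue:
  assumes "prime p" "p > 2"
  shows "\<exists>r :: nat. Legendre (int r) (int p) = -1"
proof (rule ccontr)
  assume "\<not> ?thesis"
  then have res: "QuadRes (int p) (int r)" if "\<not> p dvd r" for r
    using that unfolding Legendre_def by (auto simp: cong_0_iff split: if_splits)
  define h where "h x = x^2 mod p" for x :: nat
  have "h ` {..<p} \<supseteq> {..<p}"
  proof
    fix r assume r: "r \<in> {..<p}"
    have "\<exists>x. r = x^2 mod p"
    proof (cases "p dvd r")
      case True
      then have "r = 0" using r by (auto dest: dvd_imp_le)
      then show ?thesis by (intro exI[of _ 0]) simp
    next
      case False
      then obtain y where "[y^2 = int r] (mod int p)" using res unfolding QuadRes_def by blast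
      then have "[(int (nat \<bar>y\<bar>))^2 = int r] (mod int p)" by simp
      then have "[(nat \<bar>y\<bar>)^2 = r] (mod p)" by (metis cong_int_iff of_nat_power)
      then show ?thesis using r by (intro exI[of _ "nat \<bar>y\<bar>"]) (simp add: cong_def)
    qed
    then obtain x where "r = x^2 mod p" by blast
    then have "r = h (x mod p)" unfolding h_def by (simp add: power_mod)
    then show "r \<in> h ` {..<p}" using assms by auto
  qed
  then have "inj_on h {..<p}" by (intro finite_surj_inj) auto
  moreover have "h 1 = h (p - 1)"
  proof -
    have "(p - 1)^2 = 1 + p * (p - 2)" using assms
      by (cases p) (auto simp: power2_eq_square algebra_simps)
    then show ?thesis unfolding h_def by (simp only: power_one mod_mult_self2)
  qed
  ultimately have "1 = p - 1" using assms by (auto dest: inj_onD)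
  then show False using assms by simp
qed

lemma real_char_mod8I:
  assumes "\<And>x y. x < 8 \<Longrightarrow> y < 8 \<Longrightarrow> F (x * y mod 8) = F x * F y"
    "\<And>x. x < 8 \<Longrightarrow> F x \<in> {-1, 0, 1 :: int} \<and> (F x \<noteq> 0 \<longleftrightarrow> odd x)"
  shows "real_char 8 (\<lambda>x. F (x mod 8))"
  unfolding real_char_def
proof (intro conjI allI)
  show "F (x * y mod 8) = F (x mod 8) * F (y mod 8)" for x y
    using assms(1)[of "x mod 8" "y mod 8"] by (simp add: mod_mult_eq)
  show "F ((x + 8) mod 8) = F (x mod 8)" for x by simp
  have "x mod 8 < 8" for x :: nat by simp
  then show "F (x mod 8) \<in> {-1, 0, 1}" for x using assms(2) by blast
  have "coprime x 8 \<longleftrightarrow> odd x" for x :: nat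
  proof -
    have "(8 :: nat) = 2 ^ 3" by simp
    then have "coprime x 8 \<longleftrightarrow> coprime x (2 ^ 3)" by (simp only:)
    also have "\<dots> \<longleftrightarrow> coprime x 2" by (simp only: coprime_power_right_iff) simp
    finally show ?thesis by simp
  qed
  moreover have "odd (x mod 8) \<longleftrightarrow> odd x" for x :: nat by presburger
  ultimately show "F (x mod 8) \<noteq> 0 \<longleftrightarrow> coprime x 8" for x using assms(2)[of "x mod 8"] by simp
qed simp

text \<open>
  \<open>chi4\<close> and \<open>chi8\<close> are the Kronecker symbols of the discriminants \<open>-4\<close> and \<open>8\<close>.
\<close>

definition chi4 :: "nat \<Rightarrow> int" where
  "chi4 x = (if even x then 0 else if x mod 4 = 1 then 1 else -1)"

definition chi8 :: "nat \<Rightarrow> int" where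
  "chi8 x = (if even x then 0 else if x mod 8 = 1 \<or> x mod 8 = 7 then 1 else -1)"

lemma less_8_cases: "(x :: nat) < 8 \<Longrightarrow> x \<in> {0, 1, 2, 3, 4, 5, 6, 7}" by auto

lemma real_char_chi4: "real_char 8 chi4"
proof -
  have "real_char 8 (\<lambda>x. chi4 (x mod 8))"
  proof (rule real_char_mod8I)
    show "chi4 (x * y mod 8) = chi4 x * chi4 y" if "x < 8" "y < 8" for x y
      using less_8_cases[OF that(1)] less_8_cases[OF that(2)]
      unfolding insert_iff empty_iff by (elim disjE) (simp_all add: chi4_def)
  qed (auto simp: chi4_def)
  moreover have "chi4 (x mod 8) = chi4 x" for x
  proof -
    have "even (x mod 8) \<longleftrightarrow> even x" "x mod 8 mod 4 = x mod 4"
      by (presburger, simp add: mod_mod_cancel)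
    then show ?thesis unfolding chi4_def by simp
  qed
  ultimately show ?thesis by simp
qed

lemma real_char_chi8: "real_char 8 chi8"
proof -
  have "real_char 8 (\<lambda>x. chi8 (x mod 8))"
  proof (rule real_char_mod8I)
    show "chi8 (x * y mod 8) = chi8 x * chi8 y" if "x < 8" "y < 8" for x y
      using less_8_cases[OF that(1)] less_8_cases[OF that(2)]
      unfolding insert_iff empty_iff by (elim disjE) (simp_all add: chi8_def)
  qed (auto simp: chi8_def)
  moreover have "chi8 (x mod 8) = chi8 x" for x
  proof -
    have "even (x mod 8) \<longleftrightarrow> even x" by presburger
    then show ?thesis unfolding chi8_def by simp
  qed
  ultimately show ?thesis by simp
qed

lemma Legendre_minus_1:
  assumes "prime p" "p > 2"
  shows "Legendre (-1) (int p) = chi4 p"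
proof (rule sign_cong_imp_eq[where p = "int p"])
  have "odd p" using assms prime_odd_nat by blast
  have "chi4 p = (-1) ^ ((p - 1) div 2)"
  proof (cases "p mod 4 = 1")
    case True
    then have "even ((p - 1) div 2)" by presburger
    then show ?thesis using True \<open>odd p\<close> by (simp add: chi4_def)
  next
    case False
    then have "odd ((p - 1) div 2)" using \<open>odd p\<close> by presburger
    then show ?thesis using False \<open>odd p\<close> by (simp add: chi4_def)
  qed
  then show "[Legendre (-1) (int p) = chi4 p] (mod int p)"
    using euler_criterion[of p "-1"] assms by simp
qed (use assms Legendre_range in \<open>auto simp: chi4_def\<close>)

text \<open>
  Gauss's lemma: the doubles of \<open>1, \<dots>, h\<close> with \<open>h = (p - 1) / 2\<close> are already reduced modulo \<open>p\<close>, and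
  those that exceed \<open>h\<close> are the doubles of the numbers in \<open>{h div 2<..h}\<close>.
\<close>

lemma Legendre_2:
  assumes "prime p" "p > 2"
  shows "Legendre 2 (int p) = chi8 p"
proof -
  have odd: "odd p" using assms prime_odd_nat by blast
  interpret GAUSS p 2
    by unfold_locales (use assms in \<open>auto simp: cong_0_iff dest!: zdvd_imp_le\<close>)
  define h where "h = (int p - 1) div 2"
  have h: "int p = 2 * h + 1" unfolding h_def using odd by presburger
  have "C = (\<lambda>x. x * 2) ` {0<..h}"
    unfolding C_def B_def A_def h_def[symmetric] image_image
    by (intro image_cong refl) (use h in auto)
  then have "E = (\<lambda>x. x * 2) ` {h div 2<..h}"
    unfolding E_def h_def[symmetric] using h assms(2) by auto
  then have "card E = card {h div 2<..h}"
    by (simp add: card_image inj_on_def)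
  then have cardE: "card E = nat (h - h div 2)" by simp
  have "int (card E) = h - h div 2" using cardE h assms(2) by simp
  then have "even (card E) \<longleftrightarrow> even (h - h div 2)" by presburger
  moreover have "even (h - h div 2) \<longleftrightarrow> p mod 8 = 1 \<or> p mod 8 = 7"
  proof -
    define j where "j = int (p div 8)"
    have p: "int p = 8 * j + int (p mod 8)" unfolding j_def by presburger
    have "p mod 8 < 8" by simp
    moreover have "odd (p mod 8)" using odd by presburger
    ultimately consider "p mod 8 = 1" | "p mod 8 = 3" | "p mod 8 = 5" | "p mod 8 = 7"
      using less_8_cases[of "p mod 8"] by auto
    then show ?thesis
    proof cases
      case 1
      then have "h = 4 * j" using p h by simp
      then show ?thesis using 1 by simp
    next
      case 2
      then have "h = 4 * j + 1" using p h by simp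
      then have "h - h div 2 = 2 * j + 1" by linarith
      then show ?thesis using 2 by simp
    next
      case 3
      then have "h = 4 * j + 2" using p h by simp
      then have "h - h div 2 = 2 * j + 1" by linarith
      then show ?thesis using 3 by simp
    next
      case 4
      then have "h = 4 * j + 3" using p h by simp
      then have "h - h div 2 = 2 * j + 2" by linarith
      then show ?thesis using 4 by simp
    qed
  qed
  ultimately show ?thesis
    using gauss_lemma odd by (auto simp: chi8_def)
qed

lemma quadratic_reciprocity_sign:
  assumes "prime p" "p > 2" "prime q" "q > 2" "p \<noteq> q"
  shows "Legendre (int p) (int q) = (if q mod 4 = 3 then chi4 p else 1) * Legendre (int q) (int p)"
proof -
  have odd: "odd p" "odd q" using assms prime_odd_nat by blast+
  have rec: "Legendre (int p) (int q) * Legendre (int q) (int p) = (-1) ^ ((p - 1) div 2 * ((q - 1) div 2))"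
    by (rule Quadratic_Reciprocity) (use assms in auto)
  have sgn: "(-1) ^ ((p - 1) div 2 * ((q - 1) div 2)) = (if q mod 4 = 3 then chi4 p else 1)"
  proof (cases "q mod 4 = 3")
    case True
    then have "odd ((q - 1) div 2)" by presburger
    moreover have "even ((p - 1) div 2) \<longleftrightarrow> p mod 4 = 1" using odd(1) by presburger
    ultimately show ?thesis using True odd by (auto simp: chi4_def)
  next
    case False
    then have "even ((q - 1) div 2)" using odd(2) by presburger
    then show ?thesis using False by simp
  qed
  have "Legendre (int q) (int p) \<noteq> 0"
    using assms by (auto simp: Legendre_eq_0_iff primes_dvd_imp_eq)
  then have "Legendre (int q) (int p) * Legendre (int q) (int p) = 1"
    using Legendre_range[of "int q" "int p"] by auto
  then have "Legendre (int p) (int q) = Legendre (int p) (int q) * Legendre (int q) (int p) * Legendre (int q) (int p)"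
    by (simp add: mult.assoc)
  then show ?thesis by (simp only: rec sgn)
qed

lemma prod_prime_factors_squarefree:
  fixes n :: nat
  assumes "squarefree n"
  shows "(\<Prod>p\<in>prime_factors n. p) = n"
proof -
  have n: "n \<noteq> 0" using assms by (metis not_squarefree_0)
  have "n = (\<Prod>p\<in>prime_factors n. p ^ multiplicity p n)"
    using n by (simp add: prime_factorization_nat)
  also have "\<dots> = (\<Prod>p\<in>prime_factors n. p)"
    using assms squarefree_factorial_semiring'[OF n] by (intro prod.cong) auto
  finally show ?thesis ..
qed

lemma odd_prime_factor:
  fixes n :: nat
  assumes "odd n" "p \<in> prime_factors n"
  shows "prime p" "p > 2" "p dvd n"
proof -
  show p: "prime p" "p dvd n" using assms by auto
  show "p > 2" using p assms(1) prime_ge_2_nat[of p] by (cases "p = 2") auto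
qed

lemma Legendre_prod:
  assumes "prime l" "l > 2" "finite A"
  shows "Legendre (int (\<Prod>p\<in>A. p)) (int l) = (\<Prod>p\<in>A. Legendre (int p) (int l))"
  using assms(3)
proof (induction A rule: finite_induct)
  case empty
  then show ?case using real_char_1[OF real_char_Legendre[OF assms(1,2)]] by simp
next
  case (insert a A)
  then show ?case using Legendre_mult[OF assms(1,2)] by simp
qed

lemma real_char_prod_arg:
  assumes "real_char m f" "finite A"
  shows "f (\<Prod>p\<in>A. p) = (\<Prod>p\<in>A. f p)"
  using assms(2) real_char_1[OF assms(1)] real_charD(2)[OF assms(1)]
  by (induction A rule: finite_induct) auto

text \<open>
  Quadratic reciprocity turns the residue symbol of \<open>n\<close> modulo the prime \<open>l\<close> into a character of \<open>l\<close>
  whose modulus divides \<open>8 n\<close>.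
\<close>

lemma Legendre_reciprocity_squarefree:
  assumes n: "odd n" "squarefree n" and l: "prime l" "l > 2" "\<not> l dvd n"
  shows "Legendre (int n) (int l) =
    (if l mod 4 = 3 then chi4 n else 1) * (\<Prod>p\<in>prime_factors n. Legendre (int l) (int p))"
proof -
  have "Legendre (int n) (int l) = (\<Prod>p\<in>prime_factors n. Legendre (int p) (int l))"
    using Legendre_prod[OF l(1,2), of "prime_factors n"] prod_prime_factors_squarefree[OF n(2)] by simp
  also have "\<dots> = (\<Prod>p\<in>prime_factors n. (if l mod 4 = 3 then chi4 p else 1) * Legendre (int l) (int p))"
  proof (intro prod.cong refl quadratic_reciprocity_sign)
    fix p assume p: "p \<in> prime_factors n"
    show "prime p" "p > 2" using odd_prime_factor[OF n(1) p] by auto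
    show "p \<noteq> l" using odd_prime_factor(3)[OF n(1) p] l(3) by auto
  qed (use l in auto)
  also have "\<dots> = (if l mod 4 = 3 then chi4 n else 1) * (\<Prod>p\<in>prime_factors n. Legendre (int l) (int p))"
    using real_char_prod_arg[OF real_char_chi4, of "prime_factors n"] prod_prime_factors_squarefree[OF n(2)]
    by (simp add: prod.distrib)
  finally show ?thesis .
qed

section \<open>Sums of three squares\<close>

text \<open>
  The character \<open>\<chi>\<close> is the product of \<open>\<delta>\<close> with all Legendre symbols modulo the prime factors of \<open>n\<close>. If \<open>\<delta>\<close>
  takes the value \<open>-1\<close>, then \<open>\<chi>\<close> is independent of the Legendre symbols. If \<open>\<delta>\<close> is trivial, then \<open>\<chi>\<close> is their
  product; in this case one prime \<open>p0\<close> is left out of the prescription, and \<open>\<chi> q = 1\<close> gives the right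
  sign at \<open>p0\<close> because the prescribed signs multiply to 1.
\<close>

lemma exists_prescribed_Legendre:
  fixes n :: nat and \<epsilon> :: "nat \<Rightarrow> int"
  assumes n: "odd n" "squarefree n" and \<delta>: "real_char 8 \<delta>"
    and \<epsilon>: "\<And>p. p \<in> prime_factors n \<Longrightarrow> \<epsilon> p = 1 \<or> \<epsilon> p = -1"
    and compat: "(\<exists>r. \<delta> r = -1) \<or> (\<forall>r. odd r \<longrightarrow> \<delta> r = 1) \<and> (\<Prod>p\<in>prime_factors n. \<epsilon> p) = 1"
  shows "\<exists>q>0. coprime q (8 * n) \<and> (\<forall>p\<in>prime_factors n. Legendre (int q) (int p) = \<epsilon> p) \<and>
    (\<forall>l. prime l \<and> odd (multiplicity l q) \<longrightarrow>
      \<delta> l * (\<Prod>p\<in>prime_factors n. Legendre (int l) (int p)) = 1)"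
proof -
  define P where "P = prime_factors n"
  define m where "m = 8 * n"
  define \<psi> where "\<psi> p x = of_bool (coprime x m) * Legendre (int x) (int p)" for p x
  define \<chi> where "\<chi> x = of_bool (coprime x m) * \<delta> x * (of_bool (coprime x m) * (\<Prod>p\<in>P. \<psi> p x))" for x
  have finP: "finite P" unfolding P_def by simp
  have n0: "n > 0" using n(1) by (cases n) auto
  have m0: "m > 0" unfolding m_def using n0 by simp
  have P: "prime p" "p > 2" "p dvd n" "p dvd m" if "p \<in> P" for p
    using odd_prime_factor[OF n(1), of p] that unfolding P_def m_def by auto
  have \<psi>: "real_char m (\<psi> p)" if "p \<in> P" for p
    unfolding \<psi>_def using P[OF that] m0 by (intro real_char_restrict[of p] real_char_Legendre) auto
  have \<chi>: "real_char m \<chi>"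
    unfolding \<chi>_def
    by (intro real_char_mult real_char_restrict[OF \<delta>] real_char_prod finP m0 \<psi>) (auto simp: m_def)
  have \<chi>_eq: "\<chi> x = \<delta> x * (\<Prod>p\<in>P. Legendre (int x) (int p))" if "coprime x m" for x
    using that unfolding \<chi>_def \<psi>_def by simp
  have Legendre_1: "Legendre (int x) (int p) = 1" if "[x = 1] (mod p)" "p \<in> P" for x p
  proof -
    have "[int x = 1] (mod int p)" using that(1) by (metis cong_int_iff of_nat_1)
    then have "Legendre (int x) (int p) = Legendre 1 (int p)" by (rule Legendre_cong)
    also have "\<dots> = 1" using real_char_1[OF real_char_Legendre[OF P(1,2)[OF that(2)]]] by simp
    finally show ?thesis .
  qed
  have indep: "\<exists>a. \<psi> p a = -1 \<and> (\<forall>i\<in>P - {p}. \<psi> i a = 1) \<and> [a = 1] (mod 8)" if p: "p \<in> P" for p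
  proof -
    obtain k where k: "n = p * k" using P(3)[OF p] by (elim dvdE)
    have "\<not> p dvd k"
    proof
      assume "p dvd k"
      then have "p^2 dvd n" unfolding k power2_eq_square by (intro mult_dvd_mono) auto
      then show False using n(2) P(1)[OF p] squarefreeD[of n p] by auto
    qed
    moreover have "\<not> p dvd 8"
    proof
      assume "p dvd 8"
      then have "p dvd 2 ^ 3" by simp
      then have "p dvd 2" using P(1)[OF p] prime_dvd_power by blast
      then show False using P(2)[OF p] by (auto dest: dvd_imp_le)
    qed
    ultimately have cop: "coprime p (8 * k)"
      using P(1)[OF p] by (simp add: prime_imp_coprime prime_dvd_mult_iff)
    obtain r where r: "Legendre (int r) (int p) = -1" using exists_nonresidue P[OF p] by blast
    obtain a where a: "[a = r] (mod p)" "[a = 1] (mod 8 * k)"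
      using binary_chinese_remainder_nat[OF cop] by blast
    have "[int a = int r] (mod int p)" using a(1) by (simp add: cong_int_iff)
    then have ap: "Legendre (int a) (int p) = -1" using r Legendre_cong by metis
    then have "coprime a p" using real_charD(5)[OF real_char_Legendre[OF P(1,2)[OF p]], of a] by simp
    moreover have "coprime a (8 * k)" using a(2) by (metis cong_imp_coprime cong_sym coprime_1_left)
    ultimately have am: "coprime a m" unfolding m_def k
      by (simp add: ac_simps)
    have "[a = 1] (mod 8)" using a(2) by (rule cong_dvd_modulus_nat) simp
    moreover have "\<psi> i a = 1" if i: "i \<in> P - {p}" for i
    proof -
      have "i dvd k" using P(1,3)[of i] P(1)[OF p] i k by (auto simp: prime_dvd_mult_iff primes_dvd_imp_eq)
      then have "[a = 1] (mod i)" using a(2) by (meson cong_dvd_modulus_nat dvd_mult)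
      then show ?thesis unfolding \<psi>_def using am Legendre_1[of a i] i by simp
    qed
    ultimately show ?thesis using ap am unfolding \<psi>_def by auto
  qed
  have odd_m: "coprime x m \<Longrightarrow> odd x" for x
    unfolding m_def using coprime_divisors[of x x 2 "8 * n"] by auto
  have "\<exists>q>0. coprime q m \<and> divisor_sum \<chi> q > 0 \<and> (\<forall>p\<in>P. \<psi> p q = \<epsilon> p)"
    using compat
  proof
    assume "\<exists>r. \<delta> r = -1"
    then obtain r where r: "\<delta> r = -1" by blast
    have cop8: "coprime 8 n"
    proof -
      have "coprime (2 ^ 3) n" using n(1) by (simp only: coprime_power_left_iff coprime_left_2_iff_odd) simp
      then show ?thesis by simp
    qed
    obtain c where c: "[c = r] (mod 8)" "[c = 1] (mod n)"
      using binary_chinese_remainder_nat[OF cop8] by blast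
    have \<delta>c: "\<delta> c = -1" using real_char_cong[OF \<delta> c(1)] r by simp
    then have "coprime c 8" using real_charD(5)[OF \<delta>, of c] by simp
    moreover have "coprime c n" using c(2) by (metis cong_imp_coprime cong_sym coprime_1_left)
    ultimately have cm: "coprime c m" unfolding m_def by simp
    have Lc: "Legendre (int c) (int p) = 1" if "p \<in> P" for p
      using Legendre_1[OF _ that] c(2) P(3)[OF that] cong_dvd_modulus_nat by blast
    have "\<chi> c = -1" unfolding \<chi>_eq[OF cm] \<delta>c using Lc by simp
    moreover have "\<forall>p\<in>P. \<psi> p c = 1" unfolding \<psi>_def using cm Lc by simp
    ultimately have "\<exists>c. \<chi> c = -1 \<and> (\<forall>p\<in>P. \<psi> p c = 1)" by blast
    with indep show ?thesis
      using \<epsilon> unfolding P_def[symmetric] by (intro exists_prescribed_characters finP \<psi> \<chi>) blast+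
  next
    assume triv: "(\<forall>r. odd r \<longrightarrow> \<delta> r = 1) \<and> (\<Prod>p\<in>prime_factors n. \<epsilon> p) = 1"
    show ?thesis
    proof (cases "P = {}")
      case True
      then show ?thesis
        using real_char_1[OF \<chi>] by (intro exI[of _ 1]) (auto simp: divisor_sum_def)
    next
      case False
      then obtain p0 where p0: "p0 \<in> P" by blast
      obtain c where c: "\<psi> p0 c = -1" "\<forall>i\<in>P - {p0}. \<psi> i c = 1" using indep[OF p0] by blast
      have cm: "coprime c m" using real_charD(5)[OF \<psi>[OF p0], of c] c by simp
      have \<chi>P: "\<chi> x = \<psi> p0 x * (\<Prod>p\<in>P - {p0}. \<psi> p x)" if "coprime x m" for x
        using that triv odd_m[OF that] prod.remove[OF finP p0, of "\<lambda>p. \<psi> p x"]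
        unfolding \<chi>_def by simp
      have "\<chi> c = -1" using c \<chi>P[OF cm] by simp
      then have ind': "\<exists>c. \<chi> c = -1 \<and> (\<forall>i\<in>P - {p0}. \<psi> i c = 1)" using c(2) by blast
      have "\<exists>q>0. coprime q m \<and> divisor_sum \<chi> q > 0 \<and> (\<forall>p\<in>P - {p0}. \<psi> p q = \<epsilon> p)"
      proof (intro exists_prescribed_characters \<chi> ind')
        show "\<exists>a. \<psi> j a = -1 \<and> (\<forall>i\<in>P - {p0} - {j}. \<psi> i a = 1)" if "j \<in> P - {p0}" for j
          using indep[of j] that by blast
      qed (use finP \<psi> \<epsilon> in \<open>auto simp: P_def\<close>)
      then obtain q where q: "q > 0" "coprime q m" "divisor_sum \<chi> q > 0" "\<forall>p\<in>P - {p0}. \<psi> p q = \<epsilon> p" by blast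
      have "\<chi> q = 1" by (rule divisor_sum_pos_imp_char_1[OF \<chi> q(3,1,2)])
      then have "\<psi> p0 q * (\<Prod>p\<in>P - {p0}. \<epsilon> p) = 1" using \<chi>P[OF q(2)] q(4) by simp
      moreover have "\<epsilon> p0 * (\<Prod>p\<in>P - {p0}. \<epsilon> p) = 1"
        using triv prod.remove[OF finP p0, of \<epsilon>] unfolding P_def by simp
      ultimately have "\<psi> p0 q = \<epsilon> p0" by (metis mult_cancel_right zero_neq_one mult_zero_right)
      then show ?thesis using q by blast
    qed
  qed
  then obtain q where q: "q > 0" "coprime q m" "divisor_sum \<chi> q > 0" "\<forall>p\<in>P. \<psi> p q = \<epsilon> p" by blast
  have "\<forall>p\<in>P. Legendre (int q) (int p) = \<epsilon> p" using q(2,4) unfolding \<psi>_def by simp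
  moreover have "\<delta> l * (\<Prod>p\<in>P. Legendre (int l) (int p)) = 1" if "prime l" "odd (multiplicity l q)" for l
  proof -
    have "l dvd q" using that by (metis even_zero not_dvd_imp_multiplicity_0)
    then have "coprime l m" using q(2) by (meson coprime_divisors dvd_refl)
    then show ?thesis using \<chi>_eq divisor_sum_pos_odd_multiplicity[OF \<chi> q(3,1,2) that] by simp
  qed
  ultimately show ?thesis using q(1,2) unfolding P_def m_def by blast
qed

lemma square_congruence_squarefree:
  fixes n :: nat and c :: int
  assumes "squarefree n" "\<And>p. prime p \<Longrightarrow> p dvd n \<Longrightarrow> \<exists>x. int p dvd x^2 + c"
  shows "\<exists>x. int n dvd x^2 + c"
  using assms
proof (induction n rule: less_induct)
  case (less n)
  have n: "n \<noteq> 0" using less.prems by (metis not_squarefree_0)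
  show ?case
  proof (cases "n = 1")
    case False
    then obtain p where p: "prime p" "p dvd n" using prime_factor_nat by blast
    then obtain k where k: "n = p * k" by (elim dvdE)
    have sk: "squarefree k" using less.prems(1) k squarefree_multD by blast
    have "\<not> p dvd k"
    proof
      assume "p dvd k"
      then have "p^2 dvd n" unfolding k power2_eq_square by (intro mult_dvd_mono) auto
      then show False using less.prems(1) p(1) squarefreeD[of n p] by auto
    qed
    then have "coprime p k" using p(1) by (simp add: prime_imp_coprime)
    then have cop: "coprime (int p) (int k)" by simp
    have "1 * k < p * k" using k n prime_gt_1_nat[OF p(1)] by (intro mult_strict_right_mono) auto
    then have "k < n" using k by simp
    then obtain y where y: "int k dvd y^2 + c" using less.IH[OF _ sk] less.prems(2) k by auto
    obtain z where z: "int p dvd z^2 + c" using less.prems(2) p by blast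
    obtain x where x: "[x = z] (mod int p)" "[x = y] (mod int k)"
      using binary_chinese_remainder_int[OF cop] by blast
    have "[x^2 + c = z^2 + c] (mod int p)" "[x^2 + c = y^2 + c] (mod int k)"
      using x by (intro cong_add cong_pow cong_refl; simp)+
    then have "int p dvd x^2 + c" "int k dvd x^2 + c"
      using y z by (auto simp: cong_dvd_iff)
    then have "int p * int k dvd x^2 + c" using cop by (intro divides_mult)
    then show ?thesis unfolding k by auto
  qed auto
qed

text \<open>
  Gauss's criterion is applied with \<open>a = t q1\<close>, where \<open>q1\<close> is the squarefree part of a number \<open>q\<close> whose
  Legendre symbols are those of \<open>- t\<close>. Then \<open>- a\<close> is a square modulo \<open>n\<close>. The prime factors \<open>l\<close> of \<open>q1\<close>
  have odd multiplicity in \<open>q\<close>, and \<open>rec\<close> says that for them \<open>- n\<close> is a square modulo \<open>l\<close>.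
\<close>

lemma three_squares_via_Legendre:
  fixes n n' t :: nat and \<delta> :: "nat \<Rightarrow> int"
  assumes n': "odd n'" "squarefree n'" and n: "n = n' \<or> n = 2 * n' \<and> t = 1" and t: "t = 1 \<or> t = 2"
    and \<delta>: "real_char 8 \<delta>"
    and compat: "(\<exists>r. \<delta> r = -1) \<or>
      (\<forall>r. odd r \<longrightarrow> \<delta> r = 1) \<and> (\<Prod>p\<in>prime_factors n'. Legendre (- int t) (int p)) = 1"
    and rec: "\<And>l. prime l \<Longrightarrow> l > 2 \<Longrightarrow> \<not> l dvd n' \<Longrightarrow>
      Legendre (- int n) (int l) = \<delta> l * (\<Prod>p\<in>prime_factors n'. Legendre (int l) (int p))"
  shows "\<exists>u v w :: int. int n = u^2 + v^2 + w^2"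
proof -
  have n'0: "n' > 0" using n'(1) by (cases n') auto
  have n0: "n > 0" using n n'0 by auto
  have eps: "Legendre (- int t) (int p) = 1 \<or> Legendre (- int t) (int p) = -1" if "p \<in> prime_factors n'" for p
  proof -
    have "p > 2" using odd_prime_factor[OF n'(1) that] by simp
    then have "\<not> int p dvd - int t" using t by (auto dest: zdvd_imp_le)
    then show ?thesis using Legendre_range[of "- int t" "int p"] Legendre_eq_0_iff[of "- int t" "int p"] by auto
  qed
  obtain q where q: "q > 0" "coprime q (8 * n')"
    "\<And>p. p \<in> prime_factors n' \<Longrightarrow> Legendre (int q) (int p) = Legendre (- int t) (int p)"
    "\<And>l. prime l \<Longrightarrow> odd (multiplicity l q) \<Longrightarrow> \<delta> l * (\<Prod>p\<in>prime_factors n'. Legendre (int l) (int p)) = 1"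
    using exists_prescribed_Legendre[OF n' \<delta> eps compat] by blast
  define q1 where "q1 = squarefree_part q"
  define f where "f = square_part q"
  have qf: "q = q1 * f^2" unfolding q1_def f_def by (rule squarefree_decompose)
  have q1: "q1 > 0" using q(1) qf by (cases q1) auto
  have q1cop: "coprime q1 (8 * n')" using q(2) qf by simp
  have odd_q1: "odd q1" using q1cop coprime_divisors[of q1 q1 2 "8 * n'"] by auto
  define a where "a = t * q1"
  have sq_a: "squarefree a"
    unfolding a_def using t odd_q1 squarefree_prime[of "2 :: nat"]
    by (auto simp: q1_def intro!: squarefree_mult_coprime)
  have q1n': "coprime q1 n'" using q1cop by simp
  have "coprime a n"
    using n t q1n' n'(1) odd_q1 unfolding a_def by auto
  moreover have "\<exists>x. int n dvd x^2 + int a"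
  proof (rule square_congruence_squarefree)
    show "squarefree n"
      using n n' squarefree_prime[of "2 :: nat"] by (auto intro!: squarefree_mult_coprime)
  next
    fix p assume p: "prime p" "p dvd n"
    show "\<exists>x. int p dvd x^2 + int a"
    proof (cases "p = 2")
      case True
      have "int p dvd (int a)^2 + int a" unfolding True by simp
      then show ?thesis by blast
    next
      case False
      then have pn': "p dvd n'" using n p by (auto simp: prime_dvd_mult_iff primes_dvd_imp_eq)
      then have pP: "p \<in> prime_factors n'" using n'0 p by (simp add: prime_factors_dvd)
      have p2: "p > 2" using odd_prime_factor[OF n'(1) pP] by simp
      have "Legendre (int q) (int p) \<noteq> 0" using q(3)[OF pP] eps[OF pP] by auto
      moreover have eq: "Legendre (int q) (int p) = Legendre (int q1) (int p) * Legendre (int f) (int p)^2"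
        unfolding qf using Legendre_mult[OF p(1) p2] by (simp add: power2_eq_square)
      ultimately have "Legendre (int f) (int p)^2 = 1"
        using Legendre_range[of "int f" "int p"] by auto
      then have "Legendre (int q1) (int p) = Legendre (- int t) (int p)" using eq q(3)[OF pP] by simp
      moreover have "Legendre (- int a) (int p) = Legendre (- int t) (int p) * Legendre (int q1) (int p)"
        using Legendre_mult[OF p(1) p2, of "- int t" "int q1"] unfolding a_def by simp
      ultimately have "Legendre (- int a) (int p) = 1" using eps[OF pP] by auto
      then have "QuadRes (int p) (- int a)" unfolding Legendre_def by (auto split: if_splits)
      then show ?thesis unfolding QuadRes_def by (auto simp: cong_iff_dvd_diff)
    qed
  qed
  moreover have "\<exists>x. int a dvd x^2 + int n"
  proof (rule square_congruence_squarefree[OF sq_a])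
    fix l assume l: "prime l" "l dvd a"
    show "\<exists>x. int l dvd x^2 + int n"
    proof (cases "l = 2")
      case True
      have "int l dvd (int n)^2 + int n" unfolding True by simp
      then show ?thesis by blast
    next
      case False
      then have lq: "l dvd q1" using l t unfolding a_def by (auto simp: prime_dvd_mult_iff primes_dvd_imp_eq)
      then have "multiplicity l q1 > 0" using l(1) q1 by (simp add: prime_multiplicity_gt_zero_iff)
      moreover have "multiplicity l q1 = multiplicity l q mod 2"
        unfolding q1_def using l(1) q(1) by (simp add: prime_multiplicity_squarefree_part)
      ultimately have "odd (multiplicity l q)" by presburger
      note L = q(4)[OF l(1) this]
      have "l > 2" using False prime_ge_2_nat[OF l(1)] by simp
      moreover have "\<not> l dvd n'" using lq q1n' l(1) by (metis coprime_common_divisor not_prime_unit)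
      ultimately have "Legendre (- int n) (int l) = 1" using rec[OF l(1)] L by simp
      then have "QuadRes (int l) (- int n)" unfolding Legendre_def by (auto split: if_splits)
      then show ?thesis unfolding QuadRes_def by (auto simp: cong_iff_dvd_diff)
    qed
  qed
  ultimately show ?thesis
    using sum_of_three_squares_criterion[of "int n" "int a"] n0 q1 t unfolding a_def by auto
qed

text \<open>
  With \<open>n'\<close> the odd part of \<open>n\<close>, the character \<open>\<delta>\<close> collects what reciprocity and the symbols of \<open>-1\<close> and 2
  leave over in the symbol of \<open>- n\<close>. It is nontrivial when \<open>n\<close> is 1 or 2 modulo 4. When \<open>n\<close> is 3 modulo 8
  it is trivial, and \<open>t = 2\<close> meets the sign condition because \<open>chi4 n * chi8 n = 1\<close>.
\<close>

lemma three_squares_squarefree: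
  fixes n :: nat
  assumes n: "squarefree n" "n mod 4 = 1 \<or> n mod 4 = 2 \<or> n mod 8 = 3"
  shows "\<exists>u v w :: int. int n = u^2 + v^2 + w^2"
proof -
  have c4: "chi4 l = (if l mod 4 = 3 then -1 else 1)" if "odd l" for l
    using that unfolding chi4_def by presburger
  have Lm: "Legendre (- int k) (int l) = chi4 l * Legendre (int k) (int l)" if "prime l" "l > 2" for k l
    using Legendre_mult[OF that, of "-1" "int k"] Legendre_minus_1[OF that] by simp
  have odd: "odd l" if "prime l" "l > 2" for l :: nat using that prime_odd_nat by blast
  consider "n mod 4 = 1" | "n mod 4 = 2" | "n mod 8 = 3" using n(2) by blast
  then show ?thesis
  proof cases
    case 1
    then have on: "odd n" by presburger
    show ?thesis
    proof (rule three_squares_via_Legendre[OF on n(1), of n 1 chi4])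
      show "(\<exists>r. chi4 r = -1) \<or> (\<forall>r. odd r \<longrightarrow> chi4 r = 1) \<and>
          (\<Prod>p\<in>prime_factors n. Legendre (- int 1) (int p)) = 1"
        by (intro disjI1 exI[of _ 3]) (simp add: chi4_def)
      fix l assume l: "prime l" "l > 2" "\<not> l dvd n"
      have "chi4 n = 1" using c4[OF on] 1 by simp
      then show "Legendre (- int n) (int l) = chi4 l * (\<Prod>p\<in>prime_factors n. Legendre (int l) (int p))"
        using Lm[OF l(1,2), of n] Legendre_reciprocity_squarefree[OF on n(1) l] by simp
    qed (auto simp: real_char_chi4)
  next
    case 2
    define n' where "n' = n div 2"
    have nn: "n = 2 * n'" unfolding n'_def using 2 by presburger
    have on: "odd n'" unfolding n'_def using 2 by presburger
    have sn: "squarefree n'" using n(1) nn squarefree_multD by blast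
    define \<delta> where "\<delta> l = (if n' mod 4 = 3 then chi8 l else chi4 l * chi8 l)" for l
    have \<delta>: "real_char 8 \<delta>" unfolding \<delta>_def using real_char_chi8 real_char_mult[OF real_char_chi4 real_char_chi8]
      by (cases "n' mod 4 = 3") simp_all
    show ?thesis
    proof (rule three_squares_via_Legendre[OF on sn, of n 1 \<delta>])
      show "(\<exists>r. \<delta> r = -1) \<or> (\<forall>r. odd r \<longrightarrow> \<delta> r = 1) \<and>
          (\<Prod>p\<in>prime_factors n'. Legendre (- int 1) (int p)) = 1"
        by (intro disjI1 exI[of _ 5]) (simp add: \<delta>_def chi4_def chi8_def)
      fix l assume l: "prime l" "l > 2" "\<not> l dvd n'"
      have "Legendre (int n) (int l) = chi8 l * Legendre (int n') (int l)"
        using Legendre_mult[OF l(1,2), of 2 "int n'"] Legendre_2[OF l(1,2)] nn by simp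
      then show "Legendre (- int n) (int l) = \<delta> l * (\<Prod>p\<in>prime_factors n'. Legendre (int l) (int p))"
        using Lm[OF l(1,2), of n] Legendre_reciprocity_squarefree[OF on sn l] c4[OF on] c4[OF odd[OF l(1,2)]]
        by (simp add: \<delta>_def)
    qed (use nn \<delta> in auto)
  next
    case 3
    then have on: "odd n" by presburger
    have n4: "n mod 4 = 3" using 3 by presburger
    define \<delta> where "\<delta> l = (of_bool (coprime l 8) :: int)" for l :: nat
    have \<delta>: "real_char 8 \<delta>" unfolding \<delta>_def by (rule real_char_principal) simp
    have \<delta>1: "\<delta> l = 1" if "odd l" for l
    proof -
      have "coprime l (2 ^ 3)" using that by (simp only: coprime_power_right_iff coprime_right_2_iff_odd) simp
      then show ?thesis unfolding \<delta>_def by simp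
    qed
    show ?thesis
    proof (rule three_squares_via_Legendre[OF on n(1), of n 2 \<delta>])
      have "(\<Prod>p\<in>prime_factors n. Legendre (- int 2) (int p)) = (\<Prod>p\<in>prime_factors n. chi4 p * chi8 p)"
      proof (rule prod.cong)
        fix p assume p: "p \<in> prime_factors n"
        show "Legendre (- int 2) (int p) = chi4 p * chi8 p"
          using Lm[of p 2] Legendre_2[of p] odd_prime_factor[OF on p] by simp
      qed simp
      also have "\<dots> = chi4 n * chi8 n"
        using real_char_prod_arg[OF real_char_mult[OF real_char_chi4 real_char_chi8], of "prime_factors n"]
          prod_prime_factors_squarefree[OF n(1)] by simp
      also have "\<dots> = 1" using 3 n4 on by (simp add: chi4_def chi8_def)
      finally show "(\<exists>r. \<delta> r = -1) \<or> (\<forall>r. odd r \<longrightarrow> \<delta> r = 1) \<and>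
          (\<Prod>p\<in>prime_factors n. Legendre (- int 2) (int p)) = 1"
        using \<delta>1 by blast
      fix l assume l: "prime l" "l > 2" "\<not> l dvd n"
      show "Legendre (- int n) (int l) = \<delta> l * (\<Prod>p\<in>prime_factors n. Legendre (int l) (int p))"
        using Lm[OF l(1,2), of n] Legendre_reciprocity_squarefree[OF on n(1) l] c4[OF on] n4
          c4[OF odd[OF l(1,2)]] \<delta>1[OF odd[OF l(1,2)]]
        by simp
    qed (use \<delta> in auto)
  qed
qed

theorem three_squares:
  fixes n :: nat
  assumes n: "n mod 4 = 1 \<or> n mod 4 = 2 \<or> n mod 8 = 3"
  shows "\<exists>u v w :: int. int n = u^2 + v^2 + w^2"
proof -
  define s where "s = squarefree_part n"
  define f where "f = square_part n"
  have nf: "n = s * f^2" unfolding s_def f_def by (rule squarefree_decompose)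
  have "odd f"
  proof
    assume "even f"
    then obtain k where "f = 2 * k" by (elim evenE)
    then have "n mod 4 = 0" using nf by (simp add: power_mult_distrib)
    then show False using n by presburger
  qed
  then have "f^2 mod 8 = 1"
  proof -
    have "f mod 8 = 1 \<or> f mod 8 = 3 \<or> f mod 8 = 5 \<or> f mod 8 = 7" using \<open>odd f\<close> by presburger
    then have "(f mod 8)^2 mod 8 = 1" by auto
    then show ?thesis by (simp add: power_mod)
  qed
  then have "n mod 8 = s mod 8" unfolding nf by (metis mod_mult_right_eq mult.right_neutral)
  then have m8: "n mod 8 = s mod 8" .
  have "x mod 8 mod 4 = x mod 4" for x :: nat by (simp add: mod_mod_cancel)
  then have "n mod 4 = s mod 4" using m8 by metis
  then have "s mod 4 = 1 \<or> s mod 4 = 2 \<or> s mod 8 = 3" using n m8 by simp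
  then obtain u v w :: int where "int s = u^2 + v^2 + w^2"
    using three_squares_squarefree[of s] unfolding s_def by blast
  then have "int n = (u * int f)^2 + (v * int f)^2 + (w * int f)^2"
    unfolding nf by (simp add: power_mult_distrib algebra_simps)
  then show ?thesis by blast
qed

section \<open>Cauchy's lemma and the growth of the number of representations\<close>

lemma square_mod_4: "(x :: int)^2 mod 4 = of_bool (odd x)"
proof (cases "even x")
  case True
  then obtain k where "x = 2 * k" by (elim evenE)
  then show ?thesis by (simp add: power_mult_distrib)
next
  case False
  then obtain k where "x = 2 * k + 1" by (elim oddE)
  then have "x^2 = 1 + 4 * (k^2 + k)" by (simp add: power2_eq_square algebra_simps)
  then have "x^2 mod 4 = 1" by (simp only: mod_mult_self2) simp
  then show ?thesis using False by simp
qed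

lemma square_mod_8: "odd (x :: int) \<Longrightarrow> x^2 mod 8 = 1"
proof -
  assume "odd x"
  then obtain k where k: "x = 2 * k + 1" by (elim oddE)
  have "even (k * (k + 1))" by simp
  then obtain j where j: "k * (k + 1) = 2 * j" by (elim evenE)
  have "x^2 = 1 + 4 * (k * (k + 1))" unfolding k by (simp add: power2_eq_square algebra_simps)
  then have "x^2 = 1 + 8 * j" unfolding j by simp
  then show ?thesis by (simp only: mod_mult_self2) simp
qed

lemma abs_sum_le_of_square:
  fixes x y z b :: int
  assumes "3 * (x^2 + y^2 + z^2) \<le> b^2" "b \<ge> 0"
  shows "\<bar>x\<bar> + \<bar>y\<bar> + \<bar>z\<bar> \<le> b"
proof -
  define p q r where "p = \<bar>x\<bar>" and "q = \<bar>y\<bar>" and "r = \<bar>z\<bar>"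
  have "(p + q + r)^2 \<le> 3 * (p^2 + q^2 + r^2)"
    using zero_le_power2[of "p - q"] zero_le_power2[of "p - r"] zero_le_power2[of "q - r"]
    by (simp add: power2_eq_square algebra_simps)
  also have "\<dots> \<le> b^2" using assms unfolding p_def q_def r_def by simp
  finally show ?thesis using power2_le_imp_le assms(2) unfolding p_def q_def r_def by blast
qed

text \<open>
  Cauchy's lemma. The numbers \<open>(b \<plusminus> x \<plusminus> y \<plusminus> z) / 4\<close> with an even number of minus signs have sum \<open>b\<close> and sum
  of squares \<open>(b\<^sup>2 + x\<^sup>2 + y\<^sup>2 + z\<^sup>2) / 4 = a\<close>. They are nonnegative because
  \<open>\<bar>x\<bar> + \<bar>y\<bar> + \<bar>z\<bar> \<le> sqrt (3 (x\<^sup>2 + y\<^sup>2 + z\<^sup>2)) \<le> b\<close>. They are integers after a change of sign of \<open>x\<close>, by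
  parity considerations modulo 4.
\<close>

lemma cauchy_four_squares:
  fixes a b x y z :: int
  assumes par: "even (a - b)" and b: "b \<ge> 0" and xyz: "4 * a - b^2 = x^2 + y^2 + z^2"
    and le: "3 * (4 * a - b^2) \<le> b^2"
  shows "\<exists>s t u v. s \<ge> 0 \<and> t \<ge> 0 \<and> u \<ge> 0 \<and> v \<ge> 0 \<and> s + t + u + v = b \<and> s^2 + t^2 + u^2 + v^2 = a"
proof -
  have "(p + q + r) mod 4 = (p mod 4 + q mod 4 + r mod 4) mod 4" for p q r :: int
  proof -
    have "(p mod 4 + q mod 4 + r mod 4) mod 4 = ((p mod 4 + q mod 4) mod 4 + r mod 4) mod 4"
      by (rule mod_add_left_eq[symmetric])
    also have "(p mod 4 + q mod 4) mod 4 = (p + q) mod 4" by (rule mod_add_eq)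
    also have "((p + q) mod 4 + r mod 4) mod 4 = (p + q + r) mod 4" by (rule mod_add_eq)
    finally show ?thesis ..
  qed
  then have "(x^2 + y^2 + z^2) mod 4 = (x^2 mod 4 + y^2 mod 4 + z^2 mod 4) mod 4" .
  moreover have "(4 * a - b^2) mod 4 = (- (b^2 mod 4)) mod 4"
  proof -
    have "4 * a - b^2 = - (b^2) + 4 * a" by simp
    also have "\<dots> mod 4 = (- (b^2)) mod 4" by (rule mod_mult_self2)
    also have "\<dots> = (- (b^2 mod 4)) mod 4" by (rule mod_minus_eq[symmetric])
    finally show ?thesis .
  qed
  ultimately have "(of_bool (odd x) + of_bool (odd y) + of_bool (odd z)) mod 4 = (- of_bool (odd b)) mod (4 :: int)"
    unfolding xyz square_mod_4 by simp
  then have parity: "odd x \<longleftrightarrow> odd b" "odd y \<longleftrightarrow> odd b" "odd z \<longleftrightarrow> odd b"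
    by (cases "odd x"; cases "odd y"; cases "odd z"; cases "odd b"; simp)+
  \<comment> \<open>for even \<open>b\<close> any sign of \<open>x\<close> works because \<open>a\<close> is even; for odd \<open>b\<close> the two signs differ by 2 modulo 4\<close>
  have "\<exists>x'. x'^2 = x^2 \<and> 4 dvd b + x' + y + z \<and> (odd x' \<longleftrightarrow> odd b)"
  proof (cases "even b")
    case True
    then obtain b' x1 y1 z1 where h: "b = 2 * b'" "x = 2 * x1" "y = 2 * y1" "z = 2 * z1"
      using parity by (metis evenE)
    have "4 * a = 4 * (b'^2 + x1^2 + y1^2 + z1^2)" using xyz unfolding h by (simp add: power_mult_distrib)
    then have "a = b'^2 + x1^2 + y1^2 + z1^2" by simp
    moreover have "even a" using par True by simp
    ultimately have "even (b' + x1 + y1 + z1)" by simp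
    then obtain w where "b' + x1 + y1 + z1 = 2 * w" by (elim evenE)
    then have "b + x + y + z = 4 * w" unfolding h by simp
    then have "4 dvd b + x + y + z" by simp
    then show ?thesis using parity by blast
  next
    case False
    then obtain b' x1 y1 z1 where h: "b = 2 * b' + 1" "x = 2 * x1 + 1" "y = 2 * y1 + 1" "z = 2 * z1 + 1"
      using parity by (metis oddE)
    show ?thesis
    proof (cases "even (b' + x1 + y1 + z1)")
      case True
      then obtain w where "b' + x1 + y1 + z1 = 2 * w" by (elim evenE)
      then have "b + x + y + z = 4 * (w + 1)" unfolding h by simp
      then have "4 dvd b + x + y + z" by simp
      then show ?thesis using parity by blast
    next
      case False
      then obtain w where "b' + x1 + y1 + z1 = 2 * w + 1" by (elim oddE)
      then have "b + (- x) + y + z = 4 * (w + 1 - x1)" unfolding h by simp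
      then have "4 dvd b + (- x) + y + z" by simp
      then show ?thesis using parity by (intro exI[of _ "- x"]) auto
    qed
  qed
  then obtain x' where x': "x'^2 = x^2" "4 dvd b + x' + y + z" "odd x' \<longleftrightarrow> odd b" by blast
  obtain s where s: "b + x' + y + z = 4 * s" using x'(2) by (elim dvdE)
  have "even (y + z)" "even (x' + z)" "even (x' + y)" using parity x'(3) by auto
  then obtain p q r where pqr: "y + z = 2 * p" "x' + z = 2 * q" "x' + y = 2 * r" by (metis evenE)
  have e: "x' = q + r - p" "y = p + r - q" "z = p + q - r" "b = 4 * s - p - q - r"
    using pqr s by linarith+
  have "4 * a = b^2 + x'^2 + y^2 + z^2" using xyz x'(1) by simp
  also have "\<dots> = 4 * (s^2 + (s - p)^2 + (s - q)^2 + (s - r)^2)"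
    unfolding e by (simp add: power2_eq_square algebra_simps)
  finally have "s^2 + (s - p)^2 + (s - q)^2 + (s - r)^2 = a" by simp
  moreover have "s + (s - p) + (s - q) + (s - r) = b" using e(4) by simp
  moreover have "\<bar>x'\<bar> + \<bar>y\<bar> + \<bar>z\<bar> \<le> b"
    using le xyz x'(1) b by (intro abs_sum_le_of_square) auto
  then have "s \<ge> 0" "s - p \<ge> 0" "s - q \<ge> 0" "s - r \<ge> 0" using s pqr by linarith+
  ultimately show ?thesis by blast
qed

text \<open>
  The sum \<open>b\<close> of the four arguments is remembered, so that different \<open>b\<close> give different representations.
\<close>

lemma representation_with_sum:
  fixes k a b :: int
  assumes ab: "(k - 2) * (a - b) = 2 * (int N - b)"
    and par: "even (a - b)" and b: "b \<ge> 0" and xyz: "4 * a - b^2 = x^2 + y^2 + z^2"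
    and le: "3 * (4 * a - b^2) \<le> b^2"
  shows "b \<in> (\<lambda>(x\<^sub>1, x\<^sub>2, x\<^sub>3, x\<^sub>4). int (x\<^sub>1 + x\<^sub>2 + x\<^sub>3 + x\<^sub>4)) ` representations4 k N"
proof -
  obtain s t u v where h: "s \<ge> 0" "t \<ge> 0" "u \<ge> 0" "v \<ge> 0" "s + t + u + v = b" "s^2 + t^2 + u^2 + v^2 = a"
    using cauchy_four_squares[OF par b xyz le] by blast
  have "2 * (polygonal k s + polygonal k t + polygonal k u + polygonal k v)
      = (k - 2) * (s^2 + t^2 + u^2 + v^2) - (k - 4) * (s + t + u + v)"
    unfolding distrib_left two_polygonal by (simp add: algebra_simps)
  also have "\<dots> = (k - 2) * (a - b) + 2 * b" unfolding h(5,6) by (simp add: algebra_simps)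
  also have "\<dots> = 2 * int N" using ab by simp
  finally have "(nat s, nat t, nat u, nat v) \<in> representations4 k N"
    using h unfolding representations4_def by simp
  then show ?thesis using h by (intro image_eqI[of _ _ "(nat s, nat t, nat u, nat v)"]) auto
qed

text \<open>
  With \<open>R = 2 N / m\<close> the two inequalities say \<open>sqrt (3 R) + 3 \<le> b\<close> and \<open>b \<le> 2 sqrt R - 2\<close>. The room between
  these bounds grows like \<open>(2 - sqrt 3) sqrt R\<close>, and \<open>2 - sqrt 3 \<ge> 1 / 4\<close>.
\<close>

lemma cauchy_window:
  fixes m W :: int
  assumes "m \<ge> 1" "W \<ge> 0"
  shows "\<exists>N0. \<forall>N\<ge>N0. \<exists>L\<ge>3. \<forall>b. L \<le> b \<and> b \<le> L + W \<longrightarrow>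
    6 * int N \<le> m * (b - 3)^2 \<and> m * (b + 2)^2 \<le> 8 * int N"
proof (intro exI[of _ "nat (8 * m * (W + 6)^2)"] allI impI)
  fix N assume "nat (8 * m * (W + 6)^2) \<le> N"
  then have N: "8 * m * (W + 6)^2 \<le> int N" using assms by simp
  define R where "R = 2 * real N / real_of_int m"
  have m: "real_of_int m > 0" using assms by simp
  have R0: "R \<ge> 0" unfolding R_def using m by simp
  define X where "X = (real_of_int W + 6)^2"
  have "real_of_int (8 * m * (W + 6)^2) \<le> real N" using N by linarith
  then have "16 * X * real_of_int m \<le> 2 * real N" unfolding X_def by (simp add: mult_ac)
  moreover have "(4 * (real_of_int W + 6))^2 = 16 * X" unfolding X_def by (simp only: power_mult_distrib) simp
  ultimately have "(4 * (real_of_int W + 6))^2 \<le> R"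
    unfolding R_def using m by (simp add: le_divide_eq)
  then have sR: "4 * (real_of_int W + 6) \<le> sqrt R" by (rule real_le_rsqrt)
  have s3: "sqrt 3 \<le> 7 / 4" by (rule real_le_lsqrt) (auto simp: power2_eq_square)
  define L where "L = \<lceil>sqrt (3 * R)\<rceil> + 3"
  have ceil: "sqrt (3 * R) \<le> of_int \<lceil>sqrt (3 * R)\<rceil>" "of_int \<lceil>sqrt (3 * R)\<rceil> < sqrt (3 * R) + 1"
    by linarith+
  show "\<exists>L\<ge>3. \<forall>b. L \<le> b \<and> b \<le> L + W \<longrightarrow>
    6 * int N \<le> m * (b - 3)^2 \<and> m * (b + 2)^2 \<le> 8 * int N"
  proof (intro exI[of _ L] conjI allI impI)
    have "sqrt (3 * R) \<ge> 0" using R0 by simp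
    then show L3: "L \<ge> 3" unfolding L_def by linarith
    fix b assume b: "L \<le> b \<and> b \<le> L + W"
    have b1: "real_of_int b - 3 \<ge> sqrt (3 * R)" using b ceil unfolding L_def by linarith
    have "3 * R = (sqrt (3 * R))^2" using R0 by simp
    also have "\<dots> \<le> (real_of_int b - 3)^2" using b1 R0 by (intro power_mono) auto
    finally have "6 * real N \<le> real_of_int m * (real_of_int b - 3)^2"
      unfolding R_def using m by (simp add: field_simps)
    then have "real_of_int (6 * int N) \<le> real_of_int (m * (b - 3)^2)" by simp
    then show "6 * int N \<le> m * (b - 3)^2" by (simp only: of_int_le_iff)
    have "sqrt (3 * R) \<le> 7 / 4 * sqrt R"
      unfolding real_sqrt_mult using s3 R0 by (intro mult_right_mono) auto
    moreover have "real_of_int b \<le> real_of_int \<lceil>sqrt (3 * R)\<rceil> + 3 + real_of_int W"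
      using b unfolding L_def by linarith
    ultimately have b2: "real_of_int b + 2 \<le> 2 * sqrt R" using ceil(2) sR by (simp add: algebra_simps)
    have "(real_of_int b + 2)^2 \<le> (2 * sqrt R)^2" using b L3 b2 by (intro power_mono) auto
    also have "\<dots> = 4 * R" using R0 by (simp add: power_mult_distrib)
    finally have "real_of_int m * (real_of_int b + 2)^2 \<le> 8 * real N"
      unfolding R_def using m by (simp add: field_simps)
    then have "real_of_int (m * (b + 2)^2) \<le> real_of_int (8 * int N)" by simp
    then show "m * (b + 2)^2 \<le> 8 * int N" by (simp only: of_int_le_iff)
  qed
qed

definition sum3sq :: "int \<Rightarrow> bool" where
  "sum3sq n \<longleftrightarrow> (\<exists>x y z. n = x^2 + y^2 + z^2)"

text \<open>
  Inside the window of the previous lemma, \<open>3 a \<le> b\<^sup>2 < 4 a\<close> for the \<open>a\<close> that belongs to \<open>b\<close>, since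
  \<open>a - 2 N / (k - 2)\<close> lies between \<open>- b\<close> and \<open>b\<close>. So each \<open>b\<close> of the residue class in the window yields a
  representation, and a wide window contains \<open>K\<close> of them.
\<close>

lemma r4_ge_of_residue_class:
  fixes k D :: int
  assumes k: "k \<ge> 3" and D: "D > 0"
  shows "\<exists>N0. \<forall>N\<ge>N0. \<forall>b0. (\<forall>b. [b = b0] (mod D) \<longrightarrow> (\<exists>a. (k - 2) * (a - b) = 2 * (int N - b) \<and>
    even (a - b) \<and> (4 * a - b^2 > 0 \<longrightarrow> sum3sq (4 * a - b^2)))) \<longrightarrow> r4 k N \<ge> K"
proof -
  define m where "m = k - 2"
  have m: "m \<ge> 1" using k unfolding m_def by simp
  obtain N0 where N0: "\<And>N. N \<ge> N0 \<Longrightarrow> \<exists>L\<ge>3. \<forall>b. L \<le> b \<and> b \<le> L + int K * D \<longrightarrow>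
    6 * int N \<le> m * (b - 3)^2 \<and> m * (b + 2)^2 \<le> 8 * int N"
    using cauchy_window[OF m, of "int K * D"] D by auto
  show ?thesis
  proof (intro exI[of _ N0] allI impI)
    fix N b0 assume N: "N0 \<le> N"
      and H: "\<forall>b. [b = b0] (mod D) \<longrightarrow> (\<exists>a. (k - 2) * (a - b) = 2 * (int N - b) \<and>
        even (a - b) \<and> (4 * a - b^2 > 0 \<longrightarrow> sum3sq (4 * a - b^2)))"
    obtain L where L: "L \<ge> 3" "\<And>b. L \<le> b \<Longrightarrow> b \<le> L + int K * D \<Longrightarrow>
      6 * int N \<le> m * (b - 3)^2 \<and> m * (b + 2)^2 \<le> 8 * int N" using N0[OF N] by blast
    define b where "b i = L + (b0 - L) mod D + D * int i" for i
    have mod: "0 \<le> (b0 - L) mod D" "(b0 - L) mod D < D" using D by simp_all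
    have inj: "inj_on b {..<K}" unfolding b_def using D by (auto simp: inj_on_def)
    have "b ` {..<K} \<subseteq> (\<lambda>(x\<^sub>1, x\<^sub>2, x\<^sub>3, x\<^sub>4). int (x\<^sub>1 + x\<^sub>2 + x\<^sub>3 + x\<^sub>4)) ` representations4 k N"
    proof (rule image_subsetI)
      fix i assume "i \<in> {..<K}"
      then have "int i + 1 \<le> int K" by simp
      then have "D * (int i + 1) \<le> D * int K" using D by (intro mult_left_mono) auto
      then have range: "L \<le> b i" "b i \<le> L + int K * D"
      proof -
        have "D * (int i + 1) = D * int i + D" "int K * D = D * int K" "0 \<le> D * int i"
          using D by (simp_all add: algebra_simps)
        with \<open>D * (int i + 1) \<le> D * int K\<close> mod show "L \<le> b i" "b i \<le> L + int K * D"
          unfolding b_def by linarith+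
      qed
      have "[b i = b0] (mod D)"
        unfolding b_def cong_def by (simp add: mod_simps)
      then obtain a where a: "(k - 2) * (a - b i) = 2 * (int N - b i)" "even (a - b i)"
        "4 * a - (b i)^2 > 0 \<longrightarrow> sum3sq (4 * a - (b i)^2)" using H by blast
      have w: "6 * int N \<le> m * (b i - 3)^2" "m * (b i + 2)^2 \<le> 8 * int N" using L(2)[OF range] by auto
      have ma: "m * a = m * b i + 2 * int N - 2 * b i" using a(1) unfolding m_def by (simp add: algebra_simps)
      have b3: "b i \<ge> 3" using range L(1) by simp
      have "m * (3 * a) \<le> m * (b i)^2"
      proof -
        have "m * (3 * a) \<le> 3 * (m * b i) + m * (b i - 3)^2" using ma w(1) b3 by simp
        also have "\<dots> = m * (b i)^2 - 3 * m * (b i - 3)" by (simp add: power2_eq_square algebra_simps)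
        also have "\<dots> \<le> m * (b i)^2" using m b3 by simp
        finally show ?thesis .
      qed
      then have u: "3 * a \<le> (b i)^2" using m by simp
      have "m * (b i)^2 < m * (4 * a)"
      proof -
        have "b i \<le> m * b i" using m b3 by simp
        moreover have "m * (b i + 2)^2 = m * (b i)^2 + 4 * (m * b i) + 4 * m"
          by (simp add: power2_eq_square algebra_simps)
        moreover have "m * (4 * a) = 4 * (m * a)" by simp
        ultimately show ?thesis using ma w(2) m by linarith
      qed
      then have l: "(b i)^2 < 4 * a" using m by simp
      then obtain x y z where "4 * a - (b i)^2 = x^2 + y^2 + z^2" using a(3) unfolding sum3sq_def by auto
      then show "b i \<in> (\<lambda>(x\<^sub>1, x\<^sub>2, x\<^sub>3, x\<^sub>4). int (x\<^sub>1 + x\<^sub>2 + x\<^sub>3 + x\<^sub>4)) ` representations4 k N"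
        using representation_with_sum[OF a(1,2)] b3 u by simp
    qed
    then have "card (b ` {..<K}) \<le> card (representations4 k N)"
      by (rule surj_card_le[OF finite_representations4[OF k]])
    then show "K \<le> r4 k N" unfolding r4_def card_image[OF inj] by simp
  qed
qed

lemma sum3sq_mod:
  assumes "n > 0" "n mod 4 = 1 \<or> n mod 4 = 2 \<or> n mod 8 = 3"
  shows "sum3sq n"
proof -
  have "nat n mod 4 = nat (n mod 4)" "nat n mod 8 = nat (n mod 8)"
    using assms(1) by (simp_all add: nat_mod_distrib)
  moreover have "nat (n mod 4) = 1 \<or> nat (n mod 4) = 2 \<or> nat (n mod 8) = 3"
    using assms(2) by (elim disjE) simp_all
  ultimately have "nat n mod 4 = 1 \<or> nat n mod 4 = 2 \<or> nat n mod 8 = 3" by (simp only:)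
  then show ?thesis using three_squares[of "nat n"] assms(1) unfolding sum3sq_def by simp
qed

lemma sum3sq_mult_square: "sum3sq n \<Longrightarrow> sum3sq (c^2 * n)"
proof -
  assume "sum3sq n"
  then obtain x y z where "n = x^2 + y^2 + z^2" unfolding sum3sq_def by blast
  then have "c^2 * n = (c * x)^2 + (c * y)^2 + (c * z)^2" by (simp add: power_mult_distrib algebra_simps)
  then show ?thesis unfolding sum3sq_def by blast
qed

text \<open>
  For odd \<open>b\<close> with \<open>k - 2\<close> dividing \<open>N - b\<close>, the number \<open>a\<close> is odd as well, and \<open>4 a - b\<^sup>2\<close> is 3 modulo 8.
  Such \<open>b\<close> exist when \<open>k\<close> or \<open>N\<close> is odd.
\<close>

lemma r4_unbounded_odd:
  assumes k: "k \<ge> 3"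
  shows "\<exists>N0. \<forall>N\<ge>N0. odd k \<or> odd N \<longrightarrow> r4 k N \<ge> K"
proof -
  define m where "m = k - 2"
  have m: "m \<ge> 1" using k unfolding m_def by simp
  obtain N0 where N0: "\<And>N b0. N \<ge> N0 \<Longrightarrow> (\<forall>b. [b = b0] (mod 2 * m) \<longrightarrow> (\<exists>a. (k - 2) * (a - b) = 2 * (int N - b) \<and>
    even (a - b) \<and> (4 * a - b^2 > 0 \<longrightarrow> sum3sq (4 * a - b^2)))) \<Longrightarrow> r4 k N \<ge> K"
    using r4_ge_of_residue_class[OF k, of "2 * m" K] m by auto
  show ?thesis
  proof (intro exI[of _ N0] allI impI)
    fix N assume N: "N0 \<le> N" and odd: "odd k \<or> odd N"
    \<comment> \<open>for even \<open>N\<close> the number \<open>m = k - 2\<close> is odd\<close>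
    define b0 where "b0 = (if odd N then int N else int N + m)"
    show "K \<le> r4 k N"
    proof (rule N0[OF N, of b0], intro allI impI)
      fix b assume "[b = b0] (mod 2 * m)"
      then obtain t where t: "b = b0 + 2 * m * t" by (metis cong_iff_lin cong_sym)
      have odd_b: "odd b" using odd unfolding t b0_def m_def by auto
      obtain w where w: "int N - b = m * w"
      proof
        show "int N - b = m * ((if odd N then 0 else -1) - 2 * t)"
          unfolding t b0_def by (simp add: algebra_simps)
      qed
      define a where "a = b + 2 * w"
      have odd_a: "odd a" unfolding a_def using odd_b by simp
      have "(4 * a - b^2) mod 8 = 3"
      proof -
        obtain c where c: "a = 2 * c + 1" using odd_a by (elim oddE)
        have "4 * a - b^2 = (4 - b^2) + 8 * c" unfolding c by simp
        then have "(4 * a - b^2) mod 8 = (4 - b^2) mod 8" by (simp only: mod_mult_self2)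
        then have "(4 * a - b^2) mod 8 = (4 - b^2 mod 8) mod 8" by (simp add: mod_simps)
        then show ?thesis using square_mod_8[OF odd_b] by simp
      qed
      then have "sum3sq (4 * a - b^2)" if "4 * a - b^2 > 0" using that sum3sq_mod by blast
      moreover have "(k - 2) * (a - b) = 2 * (int N - b)" unfolding w a_def m_def by simp
      moreover have "even (a - b)" unfolding a_def by simp
      ultimately show "\<exists>a. (k - 2) * (a - b) = 2 * (int N - b) \<and> even (a - b) \<and>
          (4 * a - b^2 > 0 \<longrightarrow> sum3sq (4 * a - b^2))" by blast
    qed
  qed
qed

text \<open>
  Raising \<open>b\<close> by \<open>m = k - 2\<close>, a multiple of 4, changes \<open>a\<close> by \<open>m - 2\<close>. So \<open>b\<close> can be chosen with \<open>a\<close> equal to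
  2 modulo 4, and then \<open>a - (b / 2)\<^sup>2\<close> is 1 or 2 modulo 4.
\<close>

lemma r4_unbounded_2_mod_4:
  assumes k: "k \<ge> 3" "k mod 4 = 2"
  shows "\<exists>N0. \<forall>N\<ge>N0. even N \<longrightarrow> r4 k N \<ge> K"
proof -
  define m where "m = k - 2"
  have m: "m \<ge> 1" using k unfolding m_def by simp
  have "4 dvd m" unfolding m_def using k(2) by presburger
  then obtain j where j: "m = 4 * j" by (elim dvdE)
  obtain N0 where N0: "\<And>N b0. N \<ge> N0 \<Longrightarrow> (\<forall>b. [b = b0] (mod 2 * m) \<longrightarrow> (\<exists>a. (k - 2) * (a - b) = 2 * (int N - b) \<and>
    even (a - b) \<and> (4 * a - b^2 > 0 \<longrightarrow> sum3sq (4 * a - b^2)))) \<Longrightarrow> r4 k N \<ge> K"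
    using r4_ge_of_residue_class[OF k(1), of "2 * m" K] m by auto
  show ?thesis
  proof (intro exI[of _ N0] allI impI)
    fix N assume N: "N0 \<le> N" and even: "even N"
    then obtain h where h: "int N = 2 * h" by (metis evenE of_nat_mult of_nat_numeral)
    \<comment> \<open>\<open>b = N\<close> gives \<open>a = N\<close>, which is 2 modulo 4 when \<open>h\<close> is odd; otherwise \<open>b = N + m\<close> is used\<close>
    define \<beta> where "\<beta> = (of_bool (even h) :: int)"
    have hb: "even (h + \<beta> + 1)" unfolding \<beta>_def by auto
    define b0 where "b0 = int N + \<beta> * m"
    show "K \<le> r4 k N"
    proof (rule N0[OF N, of b0], intro allI impI)
      fix b assume "[b = b0] (mod 2 * m)"
      then obtain t where t: "b = b0 + 2 * m * t" by (metis cong_iff_lin cong_sym)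
      define w where "w = - \<beta> - 2 * t"
      have w: "int N - b = m * w" unfolding t b0_def w_def by (simp add: algebra_simps)
      define b' where "b' = h + 2 * j * \<beta> + 4 * j * t"
      have b': "b = 2 * b'" unfolding t b0_def b'_def h j by simp
      define a where "a = b + 2 * w"
      have "a = 2 * (h + \<beta> + 1) + 4 * (j * \<beta> + 2 * j * t - \<beta> - t) - 2"
        unfolding a_def w_def b' b'_def by (simp add: algebra_simps)
      moreover obtain i where "h + \<beta> + 1 = 2 * i" using hb by (elim evenE)
      moreover define c where "c = i + (j * \<beta> + 2 * j * t - \<beta> - t)"
      ultimately have c: "a = 4 * c - 2" by simp
      have T: "4 * a - b^2 = 2^2 * (a - b'^2)" unfolding b' by (simp add: power_mult_distrib)
      have "(a - b'^2) mod 4 = (2 - b'^2 mod 4) mod 4"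
      proof -
        have "a - b'^2 = (2 - b'^2) + 4 * (c - 1)" unfolding c by simp
        then have "(a - b'^2) mod 4 = (2 - b'^2) mod 4" by (simp only: mod_mult_self2)
        then show ?thesis by (simp add: mod_simps)
      qed
      then have "(a - b'^2) mod 4 = 1 \<or> (a - b'^2) mod 4 = 2" unfolding square_mod_4 by auto
      then have "sum3sq (4 * a - b^2)" if "4 * a - b^2 > 0"
        using that unfolding T by (intro sum3sq_mult_square sum3sq_mod) auto
      then show "\<exists>a. (k - 2) * (a - b) = 2 * (int N - b) \<and> even (a - b) \<and>
          (4 * a - b^2 > 0 \<longrightarrow> sum3sq (4 * a - b^2))"
        using w by (intro exI[of _ a]) (auto simp: a_def m_def)
    qed
  qed
qed

lemma power_4_part:
  fixes M :: int
  assumes "\<not> 4 ^ Suc E dvd M"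
  shows "\<exists>e\<le>E. \<exists>M'. M = 4 ^ e * M' \<and> \<not> 4 dvd M'"
  using assms
proof (induction E)
  case 0
  then have "M = 4 ^ 0 * M" "\<not> 4 dvd M" by simp_all
  then show ?case by blast
next
  case (Suc E)
  show ?case
  proof (cases "4 ^ Suc E dvd M")
    case True
    then obtain M' where M': "M = 4 ^ Suc E * M'" by (elim dvdE)
    have "\<not> 4 dvd M'"
    proof
      assume "4 dvd M'"
      then have "4 ^ Suc E * 4 dvd M" unfolding M' by (rule mult_dvd_mono[OF dvd_refl])
      then show False using Suc.prems by (simp add: mult.commute)
    qed
    then show ?thesis using M' by blast
  next
    case False
    then show ?thesis using Suc.IH by (meson le_SucI)
  qed
qed

text \<open>
  Here \<open>a\<close> cannot be moved modulo 4. With \<open>b = 2 b'\<close> and \<open>c = \<mu> b' - (\<mu> - 1)\<close> one has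
  \<open>\<mu>\<^sup>2 (a - b'\<^sup>2) = M - c\<^sup>2\<close>, where \<open>M = \<mu> N + (\<mu> - 1)\<^sup>2\<close>. As \<open>\<mu>\<close> is odd, \<open>c\<close> can be put in any residue class
  modulo a power of 2. Write \<open>M = 4 ^ e * M'\<close> with \<open>M'\<close> not divisible by 4 and take \<open>c = 2 ^ e * c'\<close>: an odd
  \<open>c'\<close> if \<open>M'\<close> is 3 modulo 4 and an even \<open>c'\<close> otherwise make \<open>M' - c'\<^sup>2\<close> equal to 1 or 2 modulo 4. The bound
  \<open>e \<le> E\<close> keeps the modulus of the residue class of \<open>b\<close> independent of \<open>N\<close>.
\<close>

lemma r4_unbounded_0_mod_4:
  fixes k \<mu> :: int
  assumes k: "k \<ge> 3" "k - 2 = 2 * \<mu>" and \<mu>: "odd \<mu>"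
  shows "\<exists>N0. \<forall>N\<ge>N0. even N \<and> \<not> 4 ^ Suc E dvd \<mu> * int N + (\<mu> - 1)^2 \<longrightarrow> r4 k N \<ge> K"
proof -
  have \<mu>0: "\<mu> > 0" using k by simp
  define D where "D = 2 * \<mu> * 2 ^ Suc E"
  have D: "D > 0" unfolding D_def using \<mu>0 by simp
  obtain N0 where N0: "\<And>N b0. N \<ge> N0 \<Longrightarrow> (\<forall>b. [b = b0] (mod D) \<longrightarrow> (\<exists>a. (k - 2) * (a - b) = 2 * (int N - b) \<and>
    even (a - b) \<and> (4 * a - b^2 > 0 \<longrightarrow> sum3sq (4 * a - b^2)))) \<Longrightarrow> r4 k N \<ge> K"
    using r4_ge_of_residue_class[OF k(1) D, of K] by blast
  show ?thesis
  proof (intro exI[of _ N0] allI impI, elim conjE)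
    fix N assume N: "N0 \<le> N" and even: "even N" and M: "\<not> 4 ^ Suc E dvd \<mu> * int N + (\<mu> - 1)^2"
    obtain h where h: "int N = 2 * h" using even by (metis evenE of_nat_mult of_nat_numeral)
    obtain e M' where e: "e \<le> E" and M': "\<mu> * int N + (\<mu> - 1)^2 = 4 ^ e * M'" "\<not> 4 dvd M'"
      using power_4_part[OF M] by blast
    \<comment> \<open>the parity of \<open>c'\<close>\<close>
    define \<eta> where "\<eta> = (of_bool (M' mod 4 = 3) :: int)"
    have cop: "coprime \<mu> (2 ^ Suc e)" using \<mu> by (simp only: coprime_power_right_iff coprime_right_2_iff_odd) simp
    obtain i where i: "[\<mu> * i = 1] (mod 2 ^ Suc e)" using cong_solve_coprime_int[OF cop] by blast
    obtain b0 where b0: "[b0 = h] (mod \<mu>)" "[b0 = i * (\<mu> - 1 + 2 ^ e * \<eta>)] (mod 2 ^ Suc e)"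
      using binary_chinese_remainder_int[OF cop] by blast
    show "K \<le> r4 k N"
    proof (rule N0[OF N, of "2 * b0"], intro allI impI)
      fix b assume "[b = 2 * b0] (mod D)"
      then obtain t where t: "b = 2 * b0 + D * t" by (metis cong_iff_lin cong_sym)
      define b' where "b' = b0 + \<mu> * 2 ^ Suc E * t"
      have b': "b = 2 * b'" unfolding t b'_def D_def by simp
      have "[b' = h] (mod \<mu>)"
        using b0(1) unfolding b'_def cong_def by (simp add: mult.assoc)
      then obtain w where w: "h = b' + \<mu> * w" by (metis cong_iff_lin)
      have "[b' = b0] (mod 2 ^ Suc e)"
      proof -
        have "(2 :: int) ^ Suc e dvd 2 ^ Suc E" using e by (intro le_imp_power_dvd) simp
        then have "2 ^ Suc e dvd b' - b0" unfolding b'_def by simp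
        then show ?thesis by (simp add: cong_iff_dvd_diff)
      qed
      then have "[\<mu> * b' = \<mu> * (i * (\<mu> - 1 + 2 ^ e * \<eta>))] (mod 2 ^ Suc e)"
        using b0(2) by (intro cong_mult cong_refl) (rule cong_trans)
      also have "\<mu> * (i * (\<mu> - 1 + 2 ^ e * \<eta>)) = (\<mu> * i) * (\<mu> - 1 + 2 ^ e * \<eta>)" by simp
      also have "[\<dots> = 1 * (\<mu> - 1 + 2 ^ e * \<eta>)] (mod 2 ^ Suc e)"
        by (intro cong_mult i cong_refl)
      finally have "2 ^ Suc e dvd \<mu> * b' - (\<mu> - 1 + 2 ^ e * \<eta>)" by (simp add: cong_iff_dvd_diff)
      then obtain s where "\<mu> * b' - (\<mu> - 1 + 2 ^ e * \<eta>) = 2 ^ Suc e * s" by (elim dvdE)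
      then have c: "\<mu> * b' - (\<mu> - 1) = 2 ^ e * (\<eta> + 2 * s)" by (simp add: algebra_simps)
      define c' where "c' = \<eta> + 2 * s"
      define a where "a = b + 2 * w"
      define T where "T = a - b'^2"
      have T4: "4 * a - b^2 = 2^2 * T" unfolding T_def b' by (simp add: power_mult_distrib)
      have "\<mu>^2 * T = (\<mu> * int N + (\<mu> - 1)^2) - (\<mu> * b' - (\<mu> - 1))^2"
        unfolding T_def a_def b' h w by (simp add: power2_eq_square algebra_simps)
      also have "\<dots> = 4 ^ e * M' - (2 ^ e * c')^2" unfolding M' c c'_def ..
      also have "(2 ^ e * c')^2 = 4 ^ e * c'^2"
      proof -
        have "(2 ^ e)^2 = ((2 :: int)^2) ^ e" by (simp only: power_mult[symmetric] mult.commute)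
        then show ?thesis by (simp add: power_mult_distrib)
      qed
      finally have eq: "\<mu>^2 * T = 4 ^ e * (M' - c'^2)" by (simp add: algebra_simps)
      have "coprime (4 ^ e) (\<mu>^2)"
      proof -
        have "coprime (2 ^ 2) \<mu>" using \<mu> by (simp only: coprime_power_left_iff coprime_left_2_iff_odd) simp
        then have "coprime 4 \<mu>" by simp
        then show ?thesis by simp
      qed
      moreover have "4 ^ e dvd \<mu>^2 * T" unfolding eq by simp
      ultimately have "4 ^ e dvd T" by (simp add: coprime_dvd_mult_right_iff)
      then obtain T' where T': "T = 4 ^ e * T'" by (elim dvdE)
      have "4 ^ e * (\<mu>^2 * T') = 4 ^ e * (M' - c'^2)" using eq unfolding T' by (simp add: algebra_simps)
      then have eq': "\<mu>^2 * T' = M' - c'^2" by simp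
      have "T' mod 4 = (\<mu>^2 mod 4) * T' mod 4" using square_mod_4[of \<mu>] \<mu> by simp
      also have "\<dots> = (\<mu>^2 * T') mod 4" by (simp add: mod_mult_left_eq)
      also have "\<dots> = (M' mod 4 - c'^2 mod 4) mod 4" unfolding eq' by (simp add: mod_simps)
      finally have T'4: "T' mod 4 = (M' mod 4 - c'^2 mod 4) mod 4" .
      have odd_c': "odd c' \<longleftrightarrow> M' mod 4 = 3" unfolding c'_def \<eta>_def by auto
      have "M' mod 4 \<in> {1, 2, 3}"
      proof -
        have "0 \<le> M' mod 4" "M' mod 4 < 4" by simp_all
        moreover have "M' mod 4 \<noteq> 0" using M'(2) by (simp add: dvd_eq_mod_eq_0)
        ultimately show ?thesis by auto
      qed
      then have T'm: "T' mod 4 = 1 \<or> T' mod 4 = 2"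
        using T'4 odd_c' unfolding square_mod_4 by auto
      have "sum3sq (4 * a - b^2)" if pos: "4 * a - b^2 > 0"
      proof -
        have eq2: "4 * a - b^2 = 2^2 * ((2 ^ e)^2 * T')"
          unfolding T4 T' by (simp add: power2_eq_square flip: power_mult_distrib)
        then have "T' > 0" using pos by (simp add: zero_less_mult_iff)
        then show ?thesis unfolding eq2 using T'm by (intro sum3sq_mult_square sum3sq_mod) auto
      qed
      moreover have "(k - 2) * (a - b) = 2 * (int N - b)"
        unfolding k(2) a_def h w b' by (simp add: algebra_simps)
      ultimately show "\<exists>a. (k - 2) * (a - b) = 2 * (int N - b) \<and> even (a - b) \<and>
          (4 * a - b^2 > 0 \<longrightarrow> sum3sq (4 * a - b^2))"
        by (intro exI[of _ a]) (auto simp: a_def)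
    qed
  qed
qed

section \<open>The 2-adic limit\<close>

text \<open>
  Since \<open>\<mu> ^ 2 ^ n\<close> is 1 modulo \<open>2 ^ n\<close>, the inverse has the residues \<open>\<mu> ^ (2 ^ n - 1)\<close>.
\<close>

lemma odd_invertible_two_adic:
  assumes "odd \<mu>"
  shows "\<exists>\<nu> :: two_adic_int. of_int \<mu> * \<nu> = 1"
proof -
  have one: "[\<mu> ^ 2 ^ n = 1] (mod 2 ^ n)" for n
  proof (induction n)
    case (Suc n)
    then have "[1 = \<mu> ^ 2 ^ n] (mod 2 ^ n)" by (rule cong_sym)
    then obtain y where y: "\<mu> ^ 2 ^ n = 1 + 2 ^ n * y" unfolding cong_iff_lin by blast
    show ?case
    proof (cases "n = 0")
      case True
      have "odd (\<mu> ^ 2)" using assms by simp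
      then have "\<mu> ^ 2 mod 2 = 1" by (simp only: odd_iff_mod_2_eq_one)
      then show ?thesis unfolding True cong_def by simp
    next
      case False
      then obtain i where i: "n = Suc i" by (cases n) auto
      have "\<mu> ^ 2 ^ Suc n = (\<mu> ^ 2 ^ n)^2" by (simp add: power_mult[symmetric] mult.commute)
      also have "\<dots> = (1 + 2 ^ n * y)^2" by (simp only: y)
      also have "\<dots> = 1 + 2 ^ Suc n * (y + 2 ^ i * y^2)" unfolding i
        by (simp add: power2_eq_square algebra_simps)
      finally show ?thesis by (simp only: cong_def mod_mult_self2)
    qed
  qed simp
  define r where "r n = \<mu> ^ (2 ^ n - 1) mod 2 ^ n" for n
  have r_Suc: "r (Suc n) mod 2 ^ n = r n" for n
  proof -
    have "(2 :: nat) ^ Suc n - 1 = 2 ^ n + (2 ^ n - 1)" by simp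
    then have "\<mu> ^ (2 ^ Suc n - 1) = \<mu> ^ 2 ^ n * \<mu> ^ (2 ^ n - 1)" by (simp only: power_add)
    moreover have "[\<mu> ^ 2 ^ n * \<mu> ^ (2 ^ n - 1) = 1 * \<mu> ^ (2 ^ n - 1)] (mod 2 ^ n)"
      by (intro cong_mult one cong_refl)
    moreover have "r (Suc n) mod 2 ^ n = \<mu> ^ (2 ^ Suc n - 1) mod 2 ^ n"
      unfolding r_def by (rule mod_mod_cancel) simp
    ultimately show ?thesis unfolding r_def cong_def by simp
  qed
  have mem: "r \<in> {x. (\<forall>n. x n \<in> {0..<2 ^ n}) \<and> (\<forall>n. x (Suc n) mod 2 ^ n = x n)}"
    using r_Suc unfolding r_def by auto
  have res: "residue (Abs_two_adic_int r) n = r n" for n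
    using Abs_two_adic_int_inverse[OF mem] by simp
  have "of_int \<mu> * Abs_two_adic_int r = 1"
  proof (rule two_adic_int_eqI)
    fix n
    have "residue (of_int \<mu> * Abs_two_adic_int r) n = (\<mu> * \<mu> ^ (2 ^ n - 1)) mod 2 ^ n"
      unfolding times_two_adic_int.rep_eq residue_of_int res r_def by (simp only: mod_mult_eq)
    also have "\<mu> * \<mu> ^ (2 ^ n - 1) = \<mu> ^ 2 ^ n"
      by (metis power_Suc Suc_pred' zero_less_power zero_less_numeral)
    also have "\<mu> ^ 2 ^ n mod 2 ^ n = 1 mod 2 ^ n" using one[of n] by (simp only: cong_def)
    finally show "residue (of_int \<mu> * Abs_two_adic_int r) n = residue 1 n"
      by (simp only: one_two_adic_int.rep_eq)
  qed
  then show ?thesis by blast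
qed

lemma of_int_two_adic_eq_0_iff: "(of_int z :: two_adic_int) = 0 \<longleftrightarrow> z = 0"
proof
  assume z: "(of_int z :: two_adic_int) = 0"
  define n where "n = nat \<bar>z\<bar>"
  have "residue (of_int z) n = 0" unfolding z by (simp add: residue_simps)
  then have "2 ^ n dvd z" by (simp add: residue_of_int mod_eq_0_iff_dvd)
  moreover have "\<bar>z\<bar> < 2 ^ n"
  proof -
    have "int n < int (2 ^ n)" using less_exp[of n] by (simp only: of_nat_less_iff)
    then show ?thesis unfolding n_def by simp
  qed
  ultimately show "z = 0" using dvd_imp_le_int[of z "2 ^ n"] by force
qed simp

lemma dist_two_adic_le:
  fixes x :: two_adic_int
  assumes "odd \<mu>" "of_int \<mu> * (x - y) = of_int M" "2 ^ n dvd M"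
  shows "dist x y \<le> (1 / 2) ^ n"
proof -
  have "residue (of_int \<mu> * (x - y)) n = 0"
    unfolding assms(2) residue_of_int using assms(3) by simp
  then have "\<mu> mod 2 ^ n * residue (x - y) n mod 2 ^ n = 0"
    by (simp only: times_two_adic_int.rep_eq residue_of_int)
  then have "2 ^ n dvd \<mu> * residue (x - y) n" by (simp add: mod_mult_left_eq mod_eq_0_iff_dvd)
  moreover have "coprime (2 ^ n) \<mu>" using assms(1) by simp
  ultimately have "2 ^ n dvd residue (x - y) n" by (simp add: coprime_dvd_mult_right_iff)
  then have "residue (x - y) n = 0" using residue_mod_self[of "x - y" n] by (metis mod_eq_0_iff_dvd)
  then show ?thesis unfolding dist_two_adic_int_def by (simp only: two_adic_abs_le_iff)
qed

text \<open>
  The terms of a strictly increasing sequence exceed every bound \<open>N0\<close>, so a property that holds for all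
  large \<open>N\<close> with few representations holds from some index on.
\<close>

lemma bounded_sequence_eventually:
  assumes "strict_mono a" "r4_bounded_on k a" "\<And>K. \<exists>N0. \<forall>N\<ge>N0. P N \<or> r4 k N \<ge> K"
  shows "\<exists>m0. \<forall>m\<ge>m0. P (a m)"
proof -
  obtain B where B: "\<And>m. r4 k (a m) \<le> B"
    using assms(2) unfolding r4_bounded_on_def bdd_above_def by auto
  obtain N0 where N0: "\<And>N. N \<ge> N0 \<Longrightarrow> P N \<or> r4 k N \<ge> Suc B" using assms(3) by blast
  have "P (a m)" if "m \<ge> N0" for m
    using N0[of "a m"] B[of m] that seq_suble[OF assms(1), of m] by fastforce
  then show ?thesis by blast
qed

theorem corollary1p4:
  fixes k :: int
  assumes "k \<ge> 3"
  shows
    "(k mod 4 = 0 \<longrightarrow>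
        (of_int (4 - 2 * k) :: two_adic_int) dvd of_int ((k - 4) ^ 2) \<and>
        (\<forall>a :: nat \<Rightarrow> nat. strict_mono a \<and> (\<forall>m. a m > 0) \<and> r4_bounded_on k a \<longrightarrow>
          (\<lambda>m. of_nat (a m) :: two_adic_int)
            \<longlonglongrightarrow> of_int ((k - 4) ^ 2) div of_int (4 - 2 * k))) \<and>
     (k mod 4 \<noteq> 0 \<longrightarrow>
        \<not> (\<exists>a :: nat \<Rightarrow> nat. strict_mono a \<and> (\<forall>m. a m > 0) \<and> r4_bounded_on k a))"
proof (intro conjI impI)
  assume k4: "k mod 4 = 0"
  then have "4 dvd k" by (simp only: dvd_eq_mod_eq_0)
  then obtain j where j: "k = 4 * j" by (elim dvdE)
  define \<mu> where "\<mu> = 2 * j - 1"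
  have \<mu>: "odd \<mu>" "k - 2 = 2 * \<mu>" unfolding \<mu>_def j by simp_all
  obtain \<nu> :: two_adic_int where \<nu>: "of_int \<mu> * \<nu> = 1" using odd_invertible_two_adic[OF \<mu>(1)] by blast
  \<comment> \<open>the limit is \<open>- (\<mu> - 1)\<^sup>2 / \<mu>\<close>, since \<open>k - 4 = 2 (\<mu> - 1)\<close> and \<open>4 - 2 k = - 4 \<mu>\<close>\<close>
  define L where "L = - \<nu> * of_int ((\<mu> - 1)^2)"
  have "4 - 2 * k = - 4 * \<mu>" "(k - 4)^2 = 4 * (\<mu> - 1)^2"
    unfolding \<mu>_def j by (simp_all add: power2_eq_square algebra_simps)
  then have "(of_int ((k - 4)^2) :: two_adic_int) = 4 * of_int ((\<mu> - 1)^2)"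
    and den: "(of_int (4 - 2 * k) :: two_adic_int) = - 4 * of_int \<mu>" by simp_all
  then have num: "(of_int ((k - 4)^2) :: two_adic_int) = of_int (4 - 2 * k) * L"
    unfolding L_def using \<nu> by (simp add: mult.assoc[symmetric])
  show "(of_int (4 - 2 * k) :: two_adic_int) dvd of_int ((k - 4)^2)" unfolding num by simp
  have "(of_int (4 - 2 * k) :: two_adic_int) \<noteq> 0"
    unfolding of_int_two_adic_eq_0_iff using assms by simp
  then have quot: "(of_int ((k - 4)^2) :: two_adic_int) div of_int (4 - 2 * k) = L"
    unfolding num by (rule nonzero_mult_div_cancel_left)
  show "\<forall>a :: nat \<Rightarrow> nat. strict_mono a \<and> (\<forall>m. a m > 0) \<and> r4_bounded_on k a \<longrightarrow>
    (\<lambda>m. of_nat (a m) :: two_adic_int) \<longlonglongrightarrow> of_int ((k - 4) ^ 2) div of_int (4 - 2 * k)"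
    unfolding quot
  proof (intro allI impI, elim conjE)
    fix a :: "nat \<Rightarrow> nat" assume a: "strict_mono a" "r4_bounded_on k a"
    show "(\<lambda>m. of_nat (a m) :: two_adic_int) \<longlonglongrightarrow> L"
    proof (rule metric_LIMSEQ_I)
      fix r :: real assume "r > 0"
      then obtain n where n: "(1 / 2) ^ n < r" using real_arch_pow_inv[of r "1 / 2"] by auto
      have "\<exists>N0. \<forall>N\<ge>N0. 4 ^ Suc n dvd \<mu> * int N + (\<mu> - 1)^2 \<or> r4 k N \<ge> K" for K
      proof -
        obtain N1 where N1: "\<And>N. N \<ge> N1 \<Longrightarrow> odd N \<Longrightarrow> r4 k N \<ge> K"
          using r4_unbounded_odd[OF assms] by blast
        obtain N2 where N2: "\<And>N. N \<ge> N2 \<Longrightarrow> even N \<Longrightarrow> \<not> 4 ^ Suc n dvd \<mu> * int N + (\<mu> - 1)^2 \<Longrightarrow> r4 k N \<ge> K"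
          using r4_unbounded_0_mod_4[OF assms \<mu>(2,1)] by blast
        show ?thesis using N1 N2 by (intro exI[of _ "max N1 N2"]) auto
      qed
      then obtain m0 where m0: "\<And>m. m \<ge> m0 \<Longrightarrow> 4 ^ Suc n dvd \<mu> * int (a m) + (\<mu> - 1)^2"
        using bounded_sequence_eventually[OF a, of "\<lambda>N. 4 ^ Suc n dvd \<mu> * int N + (\<mu> - 1)^2"] by blast
      have "dist (of_nat (a m)) L < r" if "m \<ge> m0" for m
      proof -
        have "of_int \<mu> * (of_nat (a m) - L) = of_int \<mu> * of_nat (a m) + (of_int \<mu> * \<nu>) * of_int ((\<mu> - 1)^2)"
          unfolding L_def by (simp add: algebra_simps)
        also have "\<dots> = of_int (\<mu> * int (a m) + (\<mu> - 1)^2)" unfolding \<nu> by simp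
        finally have eq: "of_int \<mu> * (of_nat (a m) - L) = of_int (\<mu> * int (a m) + (\<mu> - 1)^2)" .
        have "(2 :: int) ^ n dvd 4 ^ Suc n"
        proof -
          have "(4 :: int) ^ Suc n = 2 ^ n * (2 ^ n * 4)" by (simp flip: power_mult_distrib)
          then show ?thesis by simp
        qed
        then have "2 ^ n dvd \<mu> * int (a m) + (\<mu> - 1)^2" using m0[OF that] dvd_trans by blast
        from dist_two_adic_le[OF \<mu>(1) eq this] n show ?thesis by simp
      qed
      then show "\<exists>no. \<forall>m\<ge>no. dist (of_nat (a m) :: two_adic_int) L < r" by blast
    qed
  qed
next
  assume k4: "k mod 4 \<noteq> 0"
  show "\<not> (\<exists>a :: nat \<Rightarrow> nat. strict_mono a \<and> (\<forall>m. a m > 0) \<and> r4_bounded_on k a)"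
  proof (rule notI, elim exE conjE)
    fix a :: "nat \<Rightarrow> nat" assume a: "strict_mono a" "r4_bounded_on k a"
    have "\<exists>N0. \<forall>N\<ge>N0. False \<or> r4 k N \<ge> K" for K
    proof -
      obtain N1 where N1: "\<And>N. N \<ge> N1 \<Longrightarrow> odd k \<or> odd N \<Longrightarrow> r4 k N \<ge> K"
        using r4_unbounded_odd[OF assms] by blast
      show ?thesis
      proof (cases "odd k")
        case True
        then show ?thesis using N1 by blast
      next
        case False
        then have "k mod 4 = 2" using k4 by presburger
        then obtain N2 where N2: "\<And>N. N \<ge> N2 \<Longrightarrow> even N \<Longrightarrow> r4 k N \<ge> K"
          using r4_unbounded_2_mod_4[OF assms] by blast
        show ?thesis using N1 N2 by (intro exI[of _ "max N1 N2"]) auto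
      qed
    qed
    then show False using bounded_sequence_eventually[OF a, of "\<lambda>_. False"] by blast
  qed
qed

end
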